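(* Let $z_1,z_2\in\mathbb P$ with $z_2\neq z_1$, let $\mathtt v\in\mathbf W^{z_1}$, and set $$S(z_1)=e^3(z_1)+3e^2(z_1)i(z_1)+3e(z_1)i^2(z_1)+i^3(z_1):\mathbf W^{z_1}\to\mathbf W\otimes K_{z_1}^3 .$$ Then, as $z_2\to z_1$, $$\bigl[2\,b(z_2)T(z_1)-2\,\omega(z_2,z_1)\,b(z_1)\bigr]\mathtt v\ \longrightarrow\ S(z_1)\,\mathtt v ,$$ that is, an element of $\mathbf W\otimes K_{z_2}\otimes K_{z_1}^2$ tends to an element of $\mathbf W\otimes K_{z_1}^3$.
   Context: $\mathbb P$ is a complex projective line; $K$ its canonical bundle, $K_z$ the fibre at $z$. A coordinate is a meromorphic function $u$ on $\mathbb P$ with exactly one pole, which is simple; $du_z\in K_z$ is the value of $du$ at $z$ (for $z$ not the pole). $\mathbf K$ is the space of meromorphic 1-forms on $\mathbb P$ of the second kind (all residues zero), $\mathbf K^z\subset\mathbf K$ the subspace of forms regular at $z$; $\mathbf W=S^*\mathbf K$ and $\mathbf W^z=S^*\mathbf K^z$ are the (algebraic) symmetric algebras, with vacuum $\mathbf 1=1\in\mathbb C$. Fields: $e(z):\mathbf W\to\mathbf W\otimes K_z$ is multiplication by $e_z=-\frac{du}{(u-u(z))^2}\otimes du_z$ ($u$ any coordinate regular at $z$; $e_z$ is independent of $u$). $i(z):\mathbf W^z\to\mathbf W^z\otimes K_z$ is the derivation with $i(z)\mathbf 1=0$ and $i(z)\alpha=-\alpha(z)$ for $\alpha\in\mathbf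 K^z$. $b(z)=i(z)+e(z):\mathbf W^z\to\mathbf W\otimes K_z$. The energy-momentum tensor is $T(z)=\tfrac12\{i(z)\circ i(z)+e(z)\circ e(z)+2e(z)\circ i(z)\}:\mathbf W^z\to\mathbf W\otimes K_z^2$. In all products powers of $e$ are written to the left of powers of $i$. $\omega(z_2,z_1)=\frac{1}{(u(z_2)-u(z_1))^2}\,du_{z_2}\otimes^s du_{z_1}$, where tensor factors $K_{z_1},K_{z_2}$ are exchanged without signs; $\omega$ does not depend on the coordinate. Limits: for $\mathtt v\in\mathbf W^{z_1}$ the expressions are defined for $z_2\ne z_1$ in a Zariski neighbourhood of $z_1$ (depending on $\mathtt v$). After trivialising $K$ by $du$ near $z_1$, the degree $m$ component of the expression is a symmetric polydifferential in $m$ auxiliary points depending rationally on those points and on $u(z_2)$; the limit statement means that each component has no pole along $z_2=z_1$ and that its restriction to $z_2=z_1$ is the corresponding component of the right side. *)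

theory Defs
  imports
    "HOL-Complex_Analysis.Complex_Analysis"
    "HOL-Library.Poly_Mapping"
    "HOL-Library.Multiset"
    "HOL-Combinatorics.Permutations"
begin

section \<open>Complex vector spaces and their symmetric algebras\<close>

class complex_vector_space = ab_group_add +
  fixes scaleC :: "complex \<Rightarrow> 'a \<Rightarrow> 'a"  (infixr \<open>*\<^sub>C\<close> 75)
  assumes scaleC_add_right: "c *\<^sub>C (x + y) = c *\<^sub>C x + c *\<^sub>C y"
    and scaleC_add_left: "(c + d) *\<^sub>C x = c *\<^sub>C x + d *\<^sub>C x"
    and scaleC_scaleC: "c *\<^sub>C (d *\<^sub>C x) = (c * d) *\<^sub>C x"
    and scaleC_one: "1 *\<^sub>C x = x"

text \<open>
  The symmetric algebra of \<open>V\<close> is the polynomial ring on the set \<open>V\<close> (the monoid algebra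
  of the free commutative monoid of multisets) modulo the ideal expressing that
  the generators depend linearly on \<open>V\<close>.
\<close>

definition poly_gen :: "'a \<Rightarrow> ('a multiset \<Rightarrow>\<^sub>0 complex)" where
  "poly_gen a = Poly_Mapping.single {#a#} 1"

definition poly_const :: "complex \<Rightarrow> ('a multiset \<Rightarrow>\<^sub>0 complex)" where
  "poly_const c = Poly_Mapping.single {#} c"

inductive_set sym_ideal :: "('a::complex_vector_space multiset \<Rightarrow>\<^sub>0 complex) set" where
  zero: "0 \<in> sym_ideal"
| add: "p \<in> sym_ideal \<Longrightarrow> q \<in> sym_ideal \<Longrightarrow> p + q \<in> sym_ideal"
| rel_add: "p * (poly_gen (a + b) - poly_gen a - poly_gen b) \<in> sym_ideal"
| rel_scale: "p * (poly_gen (c *\<^sub>C a) - poly_const c * poly_gen a) \<in> sym_ideal"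

lemma sym_ideal_mult:
  assumes "p \<in> sym_ideal"
  shows "q * p \<in> sym_ideal"
  using assms
proof induction
  case zero
  show ?case by (simp add: sym_ideal.zero)
next
  case (add p r)
  then show ?case by (simp add: distrib_left sym_ideal.add)
next
  case (rel_add p a b)
  show ?case using sym_ideal.rel_add[of "q * p" a b] by (simp only: mult.assoc)
next
  case (rel_scale p c a)
  show ?case using sym_ideal.rel_scale[of "q * p" c a] by (simp only: mult.assoc)
qed

lemma poly_const_mult: "poly_const c * poly_const d = poly_const (c * d)"
  by (simp add: poly_const_def mult_single)

lemma poly_const_add: "poly_const c + poly_const d = poly_const (c + d)"
  by (simp add: poly_const_def single_add)

lemma poly_const_one: "poly_const 1 = 1"
  by (simp add: poly_const_def)

lemma sym_ideal_uminus:
  assumes "p \<in> sym_ideal"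
  shows "- p \<in> sym_ideal"
  using sym_ideal_mult[OF assms, of "- 1"] by simp

definition sym_rel ::
  "('a::complex_vector_space multiset \<Rightarrow>\<^sub>0 complex) \<Rightarrow> ('a multiset \<Rightarrow>\<^sub>0 complex) \<Rightarrow> bool" where
  "sym_rel p q \<longleftrightarrow> p - q \<in> sym_ideal"

lemma sym_rel_equivp:
  "equivp (sym_rel :: ('a::complex_vector_space multiset \<Rightarrow>\<^sub>0 complex) \<Rightarrow> _)"
proof (rule equivpI)
  show "reflp (sym_rel :: ('a multiset \<Rightarrow>\<^sub>0 complex) \<Rightarrow> _)"
    by (rule reflpI) (simp add: sym_rel_def sym_ideal.zero)
  show "symp (sym_rel :: ('a multiset \<Rightarrow>\<^sub>0 complex) \<Rightarrow> _)"
  proof (rule sympI)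
    fix p q :: "'a multiset \<Rightarrow>\<^sub>0 complex"
    assume "sym_rel p q"
    then show "sym_rel q p"
      using sym_ideal_uminus[of "p - q"] by (simp add: sym_rel_def)
  qed
  show "transp (sym_rel :: ('a multiset \<Rightarrow>\<^sub>0 complex) \<Rightarrow> _)"
  proof (rule transpI)
    fix p q r :: "'a multiset \<Rightarrow>\<^sub>0 complex"
    assume "sym_rel p q" "sym_rel q r"
    then show "sym_rel p r"
      using sym_ideal.add[of "p - q" "q - r"] by (simp add: sym_rel_def)
  qed
qed

quotient_type (overloaded) 'a sym_alg =
  "('a::complex_vector_space multiset \<Rightarrow>\<^sub>0 complex)" / sym_rel
  by (rule sym_rel_equivp)

instantiation sym_alg :: (complex_vector_space) comm_ring
begin

lift_definition zero_sym_alg :: "'a sym_alg" is 0 .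

lift_definition plus_sym_alg :: "'a sym_alg \<Rightarrow> 'a sym_alg \<Rightarrow> 'a sym_alg" is "(+)"
proof -
  fix p p' q q' :: "'a multiset \<Rightarrow>\<^sub>0 complex"
  assume "sym_rel p p'" "sym_rel q q'"
  then show "sym_rel (p + q) (p' + q')"
    using sym_ideal.add[of "p - p'" "q - q'"] by (simp add: sym_rel_def algebra_simps)
qed

lift_definition uminus_sym_alg :: "'a sym_alg \<Rightarrow> 'a sym_alg" is uminus
proof -
  fix p q :: "'a multiset \<Rightarrow>\<^sub>0 complex"
  assume "sym_rel p q"
  then show "sym_rel (- p) (- q)"
    using sym_ideal_uminus[of "p - q"] by (simp add: sym_rel_def)
qed

definition minus_sym_alg :: "'a sym_alg \<Rightarrow> 'a sym_alg \<Rightarrow> 'a sym_alg" where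
  "minus_sym_alg x y = x + (- y)"

lift_definition times_sym_alg :: "'a sym_alg \<Rightarrow> 'a sym_alg \<Rightarrow> 'a sym_alg" is "(*)"
proof -
  fix p p' q q' :: "'a multiset \<Rightarrow>\<^sub>0 complex"
  assume "sym_rel p p'" "sym_rel q q'"
  then have "q * (p - p') + p' * (q - q') \<in> sym_ideal"
    unfolding sym_rel_def by (intro sym_ideal.add sym_ideal_mult)
  then show "sym_rel (p * q) (p' * q')"
    by (simp add: sym_rel_def algebra_simps)
qed

instance
proof
  fix x y z :: "'a sym_alg"
  have eqI: "sym_rel p q" if "p = q" for p q :: "'a multiset \<Rightarrow>\<^sub>0 complex"
    using that by (simp add: sym_rel_def sym_ideal.zero)
  show "x + y + z = x + (y + z)" by transfer (rule eqI, simp add: algebra_simps)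
  show "x + y = y + x" by transfer (rule eqI, simp add: algebra_simps)
  show "0 + x = x" by transfer (rule eqI, simp)
  show "- x + x = 0" by transfer (rule eqI, simp)
  show "x - y = x + - y" by (rule minus_sym_alg_def)
  show "x * y * z = x * (y * z)" by transfer (rule eqI, simp add: algebra_simps)
  show "x * y = y * x" by transfer (rule eqI, simp add: algebra_simps)
  show "(x + y) * z = x * z + y * z" by transfer (rule eqI, simp add: algebra_simps)
qed

end

text \<open>The generators of \<open>sym_ideal\<close> have no constant term, so the algebra is not zero.\<close>

lemma lookup_times_empty:
  fixes p q :: "'a multiset \<Rightarrow>\<^sub>0 complex"
  assumes "Poly_Mapping.lookup q {#} = 0"
  shows "Poly_Mapping.lookup (p * q) {#} = 0"
proof -
  have "(\<lambda>l. Poly_Mapping.lookup p l *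
      Sum_any (\<lambda>r. Poly_Mapping.lookup q r when {#} = l + r)) = (\<lambda>_. 0)"
  proof
    fix l :: "'a multiset"
    have "(\<lambda>r. Poly_Mapping.lookup q r when {#} = l + r) = (\<lambda>_. 0)"
      by (auto simp: fun_eq_iff when_def assms)
    then show "Poly_Mapping.lookup p l *
        Sum_any (\<lambda>r. Poly_Mapping.lookup q r when {#} = l + r) = 0"
      by (simp only: Sum_any.neutral mult_zero_right)
  qed
  then show ?thesis by (simp only: lookup_mult Sum_any.neutral)
qed

lemma sym_ideal_lookup_empty: "p \<in> sym_ideal \<Longrightarrow> Poly_Mapping.lookup p {#} = 0"
proof (induction rule: sym_ideal.induct)
  case (add p q)
  then show ?case by (simp add: lookup_add)
next
  case (rel_add p a b)
  show ?case
    by (rule lookup_times_empty) (simp add: lookup_minus poly_gen_def lookup_single)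
next
  case (rel_scale p c a)
  show ?case
    by (rule lookup_times_empty)
      (simp add: lookup_minus poly_gen_def poly_const_def mult_single lookup_single)
qed simp

instantiation sym_alg :: (complex_vector_space) comm_ring_1
begin

lift_definition one_sym_alg :: "'a sym_alg" is 1 .

instance
proof
  fix x :: "'a sym_alg"
  show "1 * x = x" by transfer (simp add: sym_rel_def sym_ideal.zero)
  have "\<not> sym_rel (0 :: 'a multiset \<Rightarrow>\<^sub>0 complex) 1"
  proof
    assume "sym_rel (0 :: 'a multiset \<Rightarrow>\<^sub>0 complex) 1"
    from sym_ideal_lookup_empty[OF this[unfolded sym_rel_def]] show False
      by (simp add: lookup_minus lookup_one)
  qed
  then show "(0 :: 'a sym_alg) \<noteq> 1" by transfer
qed

end

instantiation sym_alg :: (complex_vector_space) complex_vector_space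
begin

lift_definition scaleC_sym_alg :: "complex \<Rightarrow> 'a sym_alg \<Rightarrow> 'a sym_alg" is
  "\<lambda>c p. poly_const c * p"
proof -
  fix c :: complex and p q :: "'a multiset \<Rightarrow>\<^sub>0 complex"
  assume "sym_rel p q"
  then show "sym_rel (poly_const c * p) (poly_const c * q)"
    using sym_ideal_mult[of "p - q" "poly_const c"] by (simp add: sym_rel_def algebra_simps)
qed

instance
proof
  fix c d :: complex and x y :: "'a sym_alg"
  have eqI: "sym_rel p q" if "p = q" for p q :: "'a multiset \<Rightarrow>\<^sub>0 complex"
    using that by (simp add: sym_rel_def sym_ideal.zero)
  show "c *\<^sub>C (x + y) = c *\<^sub>C x + c *\<^sub>C y"
    by transfer (rule eqI, simp add: algebra_simps)
  show "(c + d) *\<^sub>C x = c *\<^sub>C x + d *\<^sub>C x"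
    by transfer (rule eqI, simp add: algebra_simps flip: poly_const_add)
  show "c *\<^sub>C (d *\<^sub>C x) = (c * d) *\<^sub>C x"
    by transfer (rule eqI, simp add: mult.assoc flip: poly_const_mult)
  show "1 *\<^sub>C x = x"
    by transfer (rule eqI, simp add: poly_const_one)
qed

end

lift_definition sym_gen :: "'a::complex_vector_space \<Rightarrow> 'a sym_alg" is poly_gen .

text \<open>
  For a linear subspace \<open>A\<close> of \<open>V\<close>, the symmetric algebra of \<open>A\<close> embeds in that of \<open>V\<close>, and
  \<open>Sym A\<close> is its image: the subalgebra generated by \<open>A\<close>.
\<close>

inductive_set Sym :: "'a::complex_vector_space set \<Rightarrow> 'a sym_alg set" for A where
  one: "1 \<in> Sym A"
| gen: "a \<in> A \<Longrightarrow> sym_gen a \<in> Sym A"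
| add: "v \<in> Sym A \<Longrightarrow> w \<in> Sym A \<Longrightarrow> v + w \<in> Sym A"
| mult: "v \<in> Sym A \<Longrightarrow> w \<in> Sym A \<Longrightarrow> v * w \<in> Sym A"
| scale: "v \<in> Sym A \<Longrightarrow> c *\<^sub>C v \<in> Sym A"

text \<open>
  The derivation of \<open>Sym A\<close> extending a linear functional \<open>\<phi>\<close> on the subspace \<open>A\<close>,
  extended by \<open>0\<close> outside \<open>Sym A\<close>.
\<close>

definition sym_derivation ::
  "'a::complex_vector_space set \<Rightarrow> ('a \<Rightarrow> complex) \<Rightarrow> 'a sym_alg \<Rightarrow> 'a sym_alg" where
  "sym_derivation A \<phi> = (THE D.
     D 1 = 0 \<and>
     (\<forall>a\<in>A. D (sym_gen a) = \<phi> a *\<^sub>C 1) \<and>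
     (\<forall>v\<in>Sym A. \<forall>w\<in>Sym A. D (v + w) = D v + D w) \<and>
     (\<forall>c. \<forall>v\<in>Sym A. D (c *\<^sub>C v) = c *\<^sub>C D v) \<and>
     (\<forall>v\<in>Sym A. \<forall>w\<in>Sym A. D (v * w) = D v * w + v * D w) \<and>
     (\<forall>v. v \<notin> Sym A \<longrightarrow> D v = 0))"

text \<open>
  Evaluation of the component of degree \<open>m = length \<phi>s\<close>, viewed as a symmetric \<open>m\<close>-linear
  expression, on linear functionals \<open>\<phi>s\<close> on the subspace \<open>A\<close>: the product
  \<open>a\<^sub>1 \<cdots> a\<^sub>m\<close> is sent to the sum over all permutations
  \<open>\<sigma>\<close> of the products of the \<open>\<phi>\<^sub>i (a\<^bsub>\<sigma> i\<^esub>)\<close> (no factor \<open>1 / m!\<close>),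
  and the other degrees are sent to \<open>0\<close>. Extended by \<open>0\<close> outside \<open>Sym A\<close>.
\<close>

definition sym_eval ::
  "'a::complex_vector_space set \<Rightarrow> ('a \<Rightarrow> complex) list \<Rightarrow> 'a sym_alg \<Rightarrow> complex" where
  "sym_eval A \<phi>s = (THE L.
     (\<forall>as. set as \<subseteq> A \<longrightarrow> L (prod_list (map sym_gen as)) =
        (if length as = length \<phi>s
         then \<Sum>\<sigma> | \<sigma> permutes {..<length \<phi>s}. \<Prod>i<length \<phi>s. (\<phi>s ! i) (as ! \<sigma> i)
         else 0)) \<and>
     (\<forall>v\<in>Sym A. \<forall>w\<in>Sym A. L (v + w) = L v + L w) \<and>
     (\<forall>c. \<forall>v\<in>Sym A. L (c *\<^sub>C v) = c * L v) \<and>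
     (\<forall>v. v \<notin> Sym A \<longrightarrow> L v = 0))"


section \<open>The projective line, coordinates and forms of the second kind\<close>

datatype pline = Affine complex | AtInfinity

text \<open>
  The standard local parameter at each point: \<open>chart z\<close> sends \<open>0\<close> to \<open>z\<close>, and the local
  parameter is \<open>t = x - a\<close> at \<open>Affine a\<close> and \<open>t = 1 / x\<close> at infinity.
\<close>

fun chart :: "pline \<Rightarrow> complex \<Rightarrow> pline" where
  "chart (Affine a) t = Affine (a + t)"
| "chart AtInfinity t = (if t = 0 then AtInfinity else Affine (1 / t))"

text \<open>
  Meromorphic functions on the line are complex-valued, with the library convention that
  removable singularities are removed and the value at a pole is \<open>0\<close>.
\<close>

definition pole_at :: "(pline \<Rightarrow> complex) \<Rightarrow> pline \<Rightarrow> bool" where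
  "pole_at f z \<longleftrightarrow> is_pole (\<lambda>t. f (chart z t)) 0"

definition meromorphic_fun :: "(pline \<Rightarrow> complex) \<Rightarrow> bool" where
  "meromorphic_fun f \<longleftrightarrow> (\<forall>z. (\<lambda>t. f (chart z t)) nicely_meromorphic_on {0})"

definition coordinate :: "(pline \<Rightarrow> complex) \<Rightarrow> bool" where
  "coordinate u \<longleftrightarrow> meromorphic_fun u \<and>
     (\<exists>p. (\<forall>z. pole_at u z \<longleftrightarrow> z = p) \<and> zorder (\<lambda>t. u (chart p t)) 0 = - 1)"

text \<open>
  A meromorphic 1-form is \<open>f dx\<close> with \<open>f\<close> meromorphic on the affine part; the following is its
  coefficient with respect to \<open>dt\<close>, where \<open>t\<close> is the standard local parameter at a point.
\<close>

fun local_coeff :: "(complex \<Rightarrow> complex) \<Rightarrow> pline \<Rightarrow> complex \<Rightarrow> complex" where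
  "local_coeff f (Affine a) t = f (a + t)"
| "local_coeff f AtInfinity t = - f (1 / t) / t\<^sup>2"

definition second_kind :: "(complex \<Rightarrow> complex) \<Rightarrow> bool" where
  "second_kind f \<longleftrightarrow> f meromorphic_on UNIV \<and>
     (\<forall>z. local_coeff f z meromorphic_on {0} \<and> residue (local_coeff f z) 0 = 0)"

lemma remove_sings_id:
  assumes "f nicely_meromorphic_on UNIV"
  shows "remove_sings f = f"
proof
  fix x
  have "is_pole f x \<and> f x = 0 \<or> f \<midarrow>x\<rightarrow> f x"
    using assms by (auto simp: nicely_meromorphic_on_def)
  then show "remove_sings f x = f x"
    by auto
qed

lemma remove_sings_remove_sings_add:
  assumes "f meromorphic_on UNIV" "g meromorphic_on UNIV"
  shows "remove_sings (\<lambda>x. remove_sings f x + g x) = remove_sings (\<lambda>x. f x + g x)"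
proof
  fix x
  have "isolated_singularity_at f x"
    using assms(1) by (meson meromorphic_at_iff meromorphic_on_subset subset_UNIV)
  from eventually_remove_sings_eq_at[OF this]
  have "eventually (\<lambda>y. remove_sings f y + g y = f y + g y) (at x)"
    by eventually_elim simp
  then show "remove_sings (\<lambda>x. remove_sings f x + g x) x = remove_sings (\<lambda>x. f x + g x) x"
    by (rule remove_sings_cong) simp
qed

lemma remove_sings_cmult:
  assumes "f meromorphic_on UNIV"
  shows "remove_sings (\<lambda>x. c * f x) = (\<lambda>x. c * remove_sings f x)"
proof -
  have "remove_sings (\<lambda>x. c * f x) = remove_sings (\<lambda>x. c * remove_sings f x)"
  proof
    fix x
    have "isolated_singularity_at f x"
      using assms(1) by (meson meromorphic_at_iff meromorphic_on_subset subset_UNIV)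
    from eventually_remove_sings_eq_at[OF this]
    have "eventually (\<lambda>y. c * f y = c * remove_sings f y) (at x)"
      by eventually_elim simp
    then show "remove_sings (\<lambda>x. c * f x) x = remove_sings (\<lambda>x. c * remove_sings f x) x"
      by (rule remove_sings_cong) simp
  qed
  also have "\<dots> = (\<lambda>x. c * remove_sings f x)"
    by (intro remove_sings_id nicely_meromorphic_on_cmult_left remove_sings_nicely_meromorphic assms)
  finally show ?thesis .
qed

lemma eventually_local_coeff_remove_sings:
  assumes "f meromorphic_on UNIV" "local_coeff f z meromorphic_on {0}"
  shows "eventually (\<lambda>t. local_coeff (remove_sings f) z t = local_coeff f z t) (at 0)"
proof (cases z)
  case (Affine a)
  have "isolated_singularity_at f a"
    using assms(1) by (meson meromorphic_at_iff meromorphic_on_subset subset_UNIV)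
  from eventually_remove_sings_eq_at[OF this]
  have "eventually (\<lambda>t. remove_sings f (t + a) = f (t + a)) (at 0)"
    unfolding at_to_0[of a] eventually_filtermap .
  then show ?thesis
    unfolding \<open>z = Affine a\<close> by eventually_elim (simp add: add.commute)
next
  case AtInfinity
  define g where "g = local_coeff f AtInfinity"
  have "isolated_singularity_at g 0"
    using assms(2) unfolding AtInfinity g_def by (simp add: meromorphic_at_iff)
  then obtain r where r: "r > 0" "g analytic_on ball 0 r - {0}"
    by (auto simp: isolated_singularity_at_def)
  have "eventually (\<lambda>t::complex. t \<in> ball 0 r - {0}) (at 0)"
    using r by (intro eventually_at_in_open) auto
  then show ?thesis
  proof eventually_elim
    case (elim t)
    have "g analytic_on {t}" using r elim analytic_on_subset by blast
    then have "isCont g (1 / (1 / t))" by (simp add: analytic_at_imp_isCont)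
    then have "isCont (\<lambda>x. - g (1 / x) / x\<^sup>2) (1 / t)"
      using elim by (intro continuous_intros isCont_o2[of "1 / t" "\<lambda>x. 1 / x" g]) auto
    then have lim: "(\<lambda>x. - g (1 / x) / x\<^sup>2) \<midarrow>1 / t\<rightarrow> - g t / (1 / t)\<^sup>2"
      unfolding isCont_def by simp
    have eq: "- g (1 / x) / x\<^sup>2 = f x" if "x \<noteq> 0" for x
      using that unfolding g_def by (simp add: power2_eq_square)
    have "eventually (\<lambda>x. x \<in> - {0}) (at (1 / t))"
      using elim by (intro eventually_at_in_open') auto
    then have "eventually (\<lambda>x. - g (1 / x) / x\<^sup>2 = f x) (at (1 / t))"
      by eventually_elim (rule eq, simp)
    with lim have "f \<midarrow>1 / t\<rightarrow> - g t / (1 / t)\<^sup>2"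
      by (rule Lim_transform_eventually)
    moreover have "- g t / (1 / t)\<^sup>2 = f (1 / t)" using eq[of "1 / t"] elim by simp
    ultimately have "remove_sings f (1 / t) = f (1 / t)" by auto
    then show ?case by (simp add: AtInfinity)
  qed
qed

lemma second_kind_remove_sings:
  assumes "second_kind f"
  shows "second_kind (remove_sings f)"
  unfolding second_kind_def
proof safe
  show "remove_sings f meromorphic_on UNIV"
    using assms by (auto simp: second_kind_def intro: remove_sings_meromorphic)
  fix z
  have ev: "eventually (\<lambda>t. local_coeff (remove_sings f) z t = local_coeff f z t) (at 0)"
    using assms by (intro eventually_local_coeff_remove_sings) (auto simp: second_kind_def)
  have "local_coeff (remove_sings f) z meromorphic_on {0} \<longleftrightarrow> local_coeff f z meromorphic_on {0}"
    using ev by (intro meromorphic_on_cong) auto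
  then show "local_coeff (remove_sings f) z meromorphic_on {0}"
    using assms by (auto simp: second_kind_def)
  show "residue (local_coeff (remove_sings f) z) 0 = 0"
    using assms residue_cong[OF ev] by (auto simp: second_kind_def)
qed

lemma second_kind_add:
  assumes "second_kind f" "second_kind g"
  shows "second_kind (\<lambda>x. f x + g x)"
  unfolding second_kind_def
proof safe
  show "(\<lambda>x. f x + g x) meromorphic_on UNIV"
    using assms by (auto simp: second_kind_def intro: meromorphic_intros)
  fix z
  have eq: "local_coeff (\<lambda>x. f x + g x) z = (\<lambda>t. local_coeff f z t + local_coeff g z t)"
    by (cases z) (auto simp: fun_eq_iff diff_divide_distrib)
  obtain F where F: "local_coeff f z has_laurent_expansion F"
    using assms(1) by (auto simp: second_kind_def meromorphic_on_def)
  obtain G where G: "local_coeff g z has_laurent_expansion G"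
    using assms(2) by (auto simp: second_kind_def meromorphic_on_def)
  have FG: "(\<lambda>t. local_coeff f z t + local_coeff g z t) has_laurent_expansion F + G"
    by (intro laurent_expansion_intros F G)
  then show "local_coeff (\<lambda>x. f x + g x) z meromorphic_on {0}"
    unfolding eq by (auto simp: meromorphic_on_def)
  have "fls_residue F = 0" "fls_residue G = 0"
    using assms has_laurent_expansion_residue_0[OF F] has_laurent_expansion_residue_0[OF G]
    by (auto simp: second_kind_def)
  then show "residue (local_coeff (\<lambda>x. f x + g x) z) 0 = 0"
    unfolding eq using has_laurent_expansion_residue_0[OF FG] by simp
qed

lemma second_kind_cmult:
  assumes "second_kind f"
  shows "second_kind (\<lambda>x. c * f x)"
  unfolding second_kind_def
proof safe
  show "(\<lambda>x. c * f x) meromorphic_on UNIV"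
    using assms by (auto simp: second_kind_def intro: meromorphic_intros)
  fix z
  have eq: "local_coeff (\<lambda>x. c * f x) z = (\<lambda>t. c * local_coeff f z t)"
    by (cases z) (auto simp: fun_eq_iff)
  obtain F where F: "local_coeff f z has_laurent_expansion F"
    using assms(1) by (auto simp: second_kind_def meromorphic_on_def)
  have cF: "(\<lambda>t. c * local_coeff f z t) has_laurent_expansion fls_const c * F"
    by (intro laurent_expansion_intros F)
  then show "local_coeff (\<lambda>x. c * f x) z meromorphic_on {0}"
    unfolding eq by (auto simp: meromorphic_on_def)
  have "fls_residue F = 0"
    using assms has_laurent_expansion_residue_0[OF F] by (auto simp: second_kind_def)
  then show "residue (local_coeff (\<lambda>x. c * f x) z) 0 = 0"
    unfolding eq using has_laurent_expansion_residue_0[OF cF] by simp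
qed

lemma second_kind_zero: "second_kind (\<lambda>_. 0)"
proof -
  have "local_coeff (\<lambda>_. 0) z = (\<lambda>_. 0)" for z by (cases z) (auto simp: fun_eq_iff)
  then show ?thesis by (auto simp: second_kind_def residue_const)
qed

typedef form = "{f. f nicely_meromorphic_on UNIV \<and> second_kind f}"
  morphisms dx_coeff Abs_form
  by (rule exI[of _ "\<lambda>_. 0"]) (auto simp: second_kind_zero)

setup_lifting type_definition_form

text \<open>The form \<open>f dx\<close>, for \<open>f\<close> given up to removable singularities.\<close>

definition mk_form :: "(complex \<Rightarrow> complex) \<Rightarrow> form" where
  "mk_form f = Abs_form (remove_sings f)"

lemma form_meromorphic: "f nicely_meromorphic_on UNIV \<and> second_kind f \<Longrightarrow> f meromorphic_on UNIV"
  by (simp add: second_kind_def)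

instantiation form :: complex_vector_space
begin

lift_definition zero_form :: form is "\<lambda>_. 0"
  by (auto simp: second_kind_zero)

lift_definition plus_form :: "form \<Rightarrow> form \<Rightarrow> form" is "\<lambda>f g. remove_sings (\<lambda>x. f x + g x)"
  by (auto intro!: remove_sings_nicely_meromorphic second_kind_remove_sings second_kind_add
        meromorphic_intros simp: form_meromorphic)

lift_definition scaleC_form :: "complex \<Rightarrow> form \<Rightarrow> form" is "\<lambda>c f x. c * f x"
  by (auto intro: second_kind_cmult)

definition uminus_form :: "form \<Rightarrow> form" where
  "uminus_form \<alpha> = (- 1) *\<^sub>C \<alpha>"

definition minus_form :: "form \<Rightarrow> form \<Rightarrow> form" where
  "minus_form \<alpha> \<beta> = \<alpha> + (- \<beta>)"

instance
proof
  fix a b c :: form and k l :: complex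
  show comm: "a + b = b + a" for a b :: form
    by transfer (simp add: add.commute)
  show "a + b + c = a + (b + c)"
  proof transfer
    fix f g h
    assume *: "f nicely_meromorphic_on UNIV \<and> second_kind f"
      "g nicely_meromorphic_on UNIV \<and> second_kind g"
      "h nicely_meromorphic_on UNIV \<and> second_kind h"
    note m = *[THEN form_meromorphic]
    have "remove_sings (\<lambda>x. remove_sings (\<lambda>x. f x + g x) x + h x)
        = remove_sings (\<lambda>x. (f x + g x) + h x)"
      by (intro remove_sings_remove_sings_add meromorphic_intros m)
    also have "\<dots> = remove_sings (\<lambda>x. (g x + h x) + f x)"
      by (simp add: add_ac)
    also have "\<dots> = remove_sings (\<lambda>x. remove_sings (\<lambda>x. g x + h x) x + f x)"
      by (intro remove_sings_remove_sings_add[symmetric] meromorphic_intros m)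
    finally show "remove_sings (\<lambda>x. remove_sings (\<lambda>x. f x + g x) x + h x)
        = remove_sings (\<lambda>x. f x + remove_sings (\<lambda>x. g x + h x) x)"
      by (simp add: add.commute)
  qed
  show "0 + a = a"
    by transfer (simp add: remove_sings_id)
  show "- a + a = 0"
    unfolding uminus_form_def by transfer auto
  show "a - b = a + - b" by (rule minus_form_def)
  show "k *\<^sub>C (a + b) = k *\<^sub>C a + k *\<^sub>C b"
  proof transfer
    fix k f g
    assume *: "f nicely_meromorphic_on UNIV \<and> second_kind f"
      "g nicely_meromorphic_on UNIV \<and> second_kind g"
    note m = *[THEN form_meromorphic]
    have "(\<lambda>x. k * remove_sings (\<lambda>x. f x + g x) x) = remove_sings (\<lambda>x. k * (f x + g x))"
      by (intro remove_sings_cmult[symmetric] meromorphic_intros m)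
    then show "(\<lambda>x. k * remove_sings (\<lambda>x. f x + g x) x) = remove_sings (\<lambda>x. k * f x + k * g x)"
      by (simp add: distrib_left)
  qed
  show "(k + l) *\<^sub>C a = k *\<^sub>C a + l *\<^sub>C a"
  proof transfer
    fix k l f
    assume "f nicely_meromorphic_on UNIV \<and> second_kind f"
    then have "remove_sings (\<lambda>x. (k + l) * f x) = (\<lambda>x. (k + l) * f x)"
      by (intro remove_sings_id nicely_meromorphic_on_cmult_left) simp
    then show "(\<lambda>x. (k + l) * f x) = remove_sings (\<lambda>x. k * f x + l * f x)"
      by (simp add: distrib_right)
  qed
  show "k *\<^sub>C (l *\<^sub>C a) = (k * l) *\<^sub>C a"
    by transfer (simp add: mult.assoc)
  show "1 *\<^sub>C a = a"
    by transfer simp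
qed

end

text \<open>The space of forms regular at \<open>z\<close>, and its symmetric algebra.\<close>

definition K_reg :: "pline \<Rightarrow> form set" where
  "K_reg z = {\<alpha>. \<not> is_pole (local_coeff (dx_coeff \<alpha>) z) 0}"

abbreviation W_reg :: "pline \<Rightarrow> form sym_alg set" where
  "W_reg z \<equiv> Sym (K_reg z)"


section \<open>The fields, in the trivialisation given by a coordinate\<close>

text \<open>
  Let \<open>u\<close> be a coordinate. At each point \<open>z\<close> other than the pole of \<open>u\<close>, the fibre of the
  canonical bundle is spanned by \<open>du\<^sub>z\<close>. In what follows an element of the tensor product of
  the symmetric algebra with fibres at such points is represented by its coefficient with
  respect to the corresponding product of values of \<open>du\<close>.

  \<open>value_at u \<alpha> z\<close> is the coefficient of the value at \<open>z\<close> of the form \<open>\<alpha>\<close>, which is to be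
  regular at \<open>z\<close>: both \<open>\<alpha>\<close> and \<open>du\<close> are compared with \<open>dt\<close>, where \<open>t\<close> is the standard local
  parameter at \<open>z\<close>.
\<close>

definition value_at :: "(pline \<Rightarrow> complex) \<Rightarrow> form \<Rightarrow> pline \<Rightarrow> complex" where
  "value_at u \<alpha> z =
     remove_sings (local_coeff (dx_coeff \<alpha>) z) 0 / deriv (\<lambda>t. u (chart z t)) 0"

text \<open>
  The same \<open>u\<close> is used in the formula for the form \<open>e\<^sub>z\<close> and for \<open>\<omega>\<close> below as for the
  trivialisation; as elements of the tensor products these do not depend on \<open>u\<close>.
\<close>

definition e_form :: "(pline \<Rightarrow> complex) \<Rightarrow> pline \<Rightarrow> form" where
  "e_form u z =
     mk_form (\<lambda>x. - deriv (\<lambda>y. u (Affine y)) x / (u (Affine x) - u z)\<^sup>2)"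

definition e_field :: "(pline \<Rightarrow> complex) \<Rightarrow> pline \<Rightarrow> form sym_alg \<Rightarrow> form sym_alg" where
  "e_field u z v = sym_gen (e_form u z) * v"

definition i_field :: "(pline \<Rightarrow> complex) \<Rightarrow> pline \<Rightarrow> form sym_alg \<Rightarrow> form sym_alg" where
  "i_field u z = sym_derivation (K_reg z) (\<lambda>\<alpha>. - value_at u \<alpha> z)"

definition b_field :: "(pline \<Rightarrow> complex) \<Rightarrow> pline \<Rightarrow> form sym_alg \<Rightarrow> form sym_alg" where
  "b_field u z v = i_field u z v + e_field u z v"

definition T_field :: "(pline \<Rightarrow> complex) \<Rightarrow> pline \<Rightarrow> form sym_alg \<Rightarrow> form sym_alg" where
  "T_field u z v = (1 / 2) *\<^sub>C
     (i_field u z (i_field u z v) + e_field u z (e_field u z v)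
      + 2 *\<^sub>C e_field u z (i_field u z v))"

definition S_field :: "(pline \<Rightarrow> complex) \<Rightarrow> pline \<Rightarrow> form sym_alg \<Rightarrow> form sym_alg" where
  "S_field u z v =
     e_field u z (e_field u z (e_field u z v))
     + 3 *\<^sub>C e_field u z (e_field u z (i_field u z v))
     + 3 *\<^sub>C e_field u z (i_field u z (i_field u z v))
     + i_field u z (i_field u z (i_field u z v))"

definition omega :: "(pline \<Rightarrow> complex) \<Rightarrow> pline \<Rightarrow> pline \<Rightarrow> complex" where
  "omega u z2 z1 = 1 / (u z2 - u z1)\<^sup>2"


section \<open>Limits of vectors depending on a point\<close>

text \<open>
  The component of degree \<open>length xs\<close> of \<open>v\<close>, as a symmetric polydifferential evaluated at the
  points \<open>xs\<close>. It is regular there if \<open>v\<close> is in the symmetric algebra of the space of forms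
  that are regular at all of these points.
\<close>

definition polydiff_regular :: "pline list \<Rightarrow> form sym_alg \<Rightarrow> bool" where
  "polydiff_regular xs v \<longleftrightarrow> v \<in> Sym (\<Inter>x\<in>set xs. K_reg x)"

definition polydiff :: "(pline \<Rightarrow> complex) \<Rightarrow> pline list \<Rightarrow> form sym_alg \<Rightarrow> complex" where
  "polydiff u xs = sym_eval (\<Inter>x\<in>set xs. K_reg x) (map (\<lambda>x \<alpha>. value_at u \<alpha> x) xs)"

text \<open>Polynomial functions in \<open>n\<close> complex variables, given as a list of length \<open>n\<close>.\<close>

inductive polynomial_fun :: "nat \<Rightarrow> (complex list \<Rightarrow> complex) \<Rightarrow> bool" for n where
  const: "polynomial_fun n (\<lambda>_. c)"
| var: "i < n \<Longrightarrow> polynomial_fun n (\<lambda>xs. xs ! i)"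
| add: "polynomial_fun n f \<Longrightarrow> polynomial_fun n g \<Longrightarrow> polynomial_fun n (\<lambda>xs. f xs + g xs)"
| mult: "polynomial_fun n f \<Longrightarrow> polynomial_fun n g \<Longrightarrow> polynomial_fun n (\<lambda>xs. f xs * g xs)"

text \<open>
  \<open>F z\<close> tends to \<open>w\<close> as \<open>z\<close> tends to \<open>z1\<close>: there is a Zariski neighbourhood of \<open>z1\<close> (the
  complement of a finite set \<open>B\<close> and of the pole of \<open>u\<close>) over which, for each \<open>m\<close>, the degree
  \<open>m\<close> component of \<open>F z\<close> for \<open>z \<noteq> z1\<close>, and that of \<open>w\<close> for \<open>z = z1\<close>, is given by one and the
  same rational function \<open>P / Q\<close> of the coordinates of the \<open>m\<close> auxiliary points and of \<open>z\<close>.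
  The nonvanishing of \<open>Q\<close> is required for \<open>z = z1\<close> too: no pole along the divisor \<open>z = z1\<close>.
\<close>

definition tends_to ::
  "(pline \<Rightarrow> complex) \<Rightarrow> pline \<Rightarrow> (pline \<Rightarrow> form sym_alg) \<Rightarrow> form sym_alg \<Rightarrow> bool" where
  "tends_to u z1 F w \<longleftrightarrow>
    (\<exists>B. finite B \<and> z1 \<notin> B \<and>
      (\<forall>m. \<exists>P Q. polynomial_fun (Suc m) P \<and> polynomial_fun (Suc m) Q \<and>
        (\<forall>z. z \<notin> B \<and> \<not> pole_at u z \<longrightarrow>
          (\<exists>xs. length xs = m \<and> (\<forall>x\<in>set xs. \<not> pole_at u x) \<and> Q (map u xs @ [u z]) \<noteq> 0) \<and>
          (\<forall>xs. length xs = m \<and> (\<forall>x\<in>set xs. \<not> pole_at u x) \<and> Q (map u xs @ [u z]) \<noteq> 0 \<longrightarrow>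
            (let v = (if z = z1 then w else F z) in
              polydiff_regular xs v \<and>
              polydiff u xs v = P (map u xs @ [u z]) / Q (map u xs @ [u z]))))))"

end

theory Submission
  imports Defs
begin

text \<open>
  Write \<open>e = e(z\<^sub>1)\<close>, \<open>i = i(z\<^sub>1)\<close>, \<open>E = e(z)\<close>, \<open>I = i(z)\<close>. The derivation \<open>I\<close> sends the vector \<open>e\<close> to
  minus its value at \<open>z\<close>, which is \<open>\<omega>(z, z\<^sub>1)\<close>; hence \<open>I e = e I + \<omega>\<close> is the only commutation relation
  involved. Moving \<open>I\<close> to the right in \<open>(I + E)(i i + e e + 2 e i) v\<close> therefore produces the normally
  ordered expression
  \<open>G(z) = I i i v + e e I v + 2 e I i v + E (i i + e e + 2 e i) v\<close>
  together with the terms \<open>2 \<omega> (e + i) v = 2 \<omega> b(z\<^sub>1) v\<close>. These are exactly the subtracted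
  terms, so that the expression whose limit is sought is equal to \<open>G(z)\<close> for \<open>z \<noteq> z\<^sub>1\<close>
  (\<open>b_T_minus_contraction\<close>). The poles of \<open>G\<close> on the diagonal are gone, and \<open>G(z\<^sub>1) = S(z\<^sub>1) v\<close>.

  It remains to see that \<open>G\<close> depends rationally on \<open>z\<close> near \<open>z\<^sub>1\<close>, in the sense of components. The vector \<open>v\<close>
  is a polynomial in finitely many forms regular at \<open>z\<^sub>1\<close>, and the value of such a form, as a function
  of the coordinate, is rational with a denominator that does not vanish at \<open>z\<^sub>1\<close>
  (\<open>forms_common_denominator\<close>); the form \<open>e(z)\<close> has value \<open>- 1 / (x - z)\<^sup>2\<close> at \<open>x\<close>. So \<open>G(z)\<close> is a
  sum of monomials in these forms with coefficients rational in \<open>z\<close>, and the component of a monomial of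
  degree \<open>m\<close> is the permanent of the values of its factors, which is rational in the \<open>m\<close> points and
  \<open>z\<close> (\<open>rational_family_component\<close>). The pole \<open>x = z\<close> of \<open>e(z)\<close> is harmless, since it is not contained in
  the divisor \<open>z = z\<^sub>1\<close>.

  Two foundations are needed on the way. The derivation \<open>i(z)\<close> and the evaluation of components are
  specified by their values on generators of a subalgebra; their existence is obtained by
  extending functionals from a subspace to the whole space and differentiating polynomials
  (\<open>total_derivation\<close>), the evaluation at \<open>m\<close> functionals being the constant term of an
  \<open>m\<close>-fold derivative. And coordinates are Moebius transformations, forms are rational:
  both follow from Liouville's theorem on entire functions of polynomial growth.
\<close>

section \<open>Linear functionals on subspaces\<close>

definition complex_linear_on :: "'a::complex_vector_space set \<Rightarrow> ('a \<Rightarrow> complex) \<Rightarrow> bool" where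
  "complex_linear_on A \<phi> \<longleftrightarrow> 0 \<in> A \<and>
     (\<forall>a\<in>A. \<forall>b\<in>A. a + b \<in> A \<and> \<phi> (a + b) = \<phi> a + \<phi> b) \<and>
     (\<forall>c. \<forall>a\<in>A. c *\<^sub>C a \<in> A \<and> \<phi> (c *\<^sub>C a) = c * \<phi> a)"

lemma vector_space_scaleC: "vector_space (scaleC :: complex \<Rightarrow> 'a \<Rightarrow> 'a::complex_vector_space)"
  by unfold_locales (simp_all add: scaleC_add_left scaleC_add_right scaleC_scaleC scaleC_one)

lemma scaleC_zero_left [simp]: "0 *\<^sub>C (x::'a::complex_vector_space) = 0"
  using scaleC_add_left[of 0 0 x] by simp

text \<open>
  A derivation of the whole symmetric algebra needs a functional on the whole space, whereas values at
  a point are functionals only on the forms regular there; any basis of the subspace can be used to extend.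
\<close>

lemma complex_linear_extend:
  assumes "complex_linear_on A \<phi>"
  obtains \<psi> where "complex_linear_on UNIV \<psi>" "\<And>a. a \<in> A \<Longrightarrow> \<psi> a = \<phi> a"
proof -
  interpret vector_space_pair "scaleC :: complex \<Rightarrow> 'a \<Rightarrow> 'a" "(*) :: complex \<Rightarrow> complex \<Rightarrow> complex"
    by (intro vector_space_pair.intro vector_space_scaleC) (unfold_locales, simp_all add: algebra_simps)
  obtain B where B: "B \<subseteq> A" "vs1.independent B" "A \<subseteq> vs1.span B"
    using vs1.maximal_independent_subset .
  obtain g where g: "Vector_Spaces.linear scaleC (*) g" "\<forall>x\<in>B. g x = \<phi> x"
    using linear_independent_extend[OF B(2)] by blast
  note lin = module_hom.add[OF g(1)[unfolded linear_iff_module_hom]]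
     module_hom.scale[OF g(1)[unfolded linear_iff_module_hom]]
  have \<phi>0: "\<phi> 0 = 0"
    using assms unfolding complex_linear_on_def by (metis mult_zero_left scaleC_zero_left)
  have ext: "y \<in> A \<and> g y = \<phi> y" if "y \<in> vs1.span B" for y
    using that
  proof (induction rule: vs1.span_induct_alt)
    case base
    show ?case using assms \<phi>0 lin(2)[of 0 0] by (simp add: complex_linear_on_def)
  next
    case (step c x y)
    have "x \<in> A" "g x = \<phi> x" using B g step by auto
    then show ?case using step assms unfolding complex_linear_on_def by (simp add: lin)
  qed
  show ?thesis
  proof (rule that)
    show "complex_linear_on UNIV g" by (simp add: complex_linear_on_def lin)
  qed (use ext B in blast)
qed

section \<open>Derivations of the symmetric algebra\<close>

lemma poly_mapping_additive_induct [case_names zero single add]: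
  assumes "P 0" "\<And>k c. P (Poly_Mapping.single k c)"
    "\<And>p q. P p \<Longrightarrow> P q \<Longrightarrow> P (p + q)"
  shows "P (p :: 'k \<Rightarrow>\<^sub>0 'v::comm_monoid_add)"
proof -
  have eq: "p = (\<Sum>k\<in>Poly_Mapping.keys p. Poly_Mapping.single k (Poly_Mapping.lookup p k))"
    by (rule poly_mapping_eqI) (simp add: lookup_sum lookup_single when_def in_keys_iff)
  have "P (\<Sum>k\<in>K. Poly_Mapping.single k (Poly_Mapping.lookup p k))" for K
    by (induction K rule: infinite_finite_induct) (simp_all add: assms)
  then show ?thesis by (subst eq)
qed

text \<open>The derivation of the polynomial ring sending the variable \<open>a\<close> to the constant \<open>\<psi> a\<close>.\<close>

definition poly_derivation ::
  "('a \<Rightarrow> complex) \<Rightarrow> ('a multiset \<Rightarrow>\<^sub>0 complex) \<Rightarrow> ('a multiset \<Rightarrow>\<^sub>0 complex)" where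
  "poly_derivation \<psi> p = (\<Sum>M\<in>Poly_Mapping.keys p. \<Sum>a\<in>#M.
     Poly_Mapping.single (M - {#a#}) (Poly_Mapping.lookup p M * \<psi> a))"

lemma poly_derivation_superset:
  assumes "finite S" "Poly_Mapping.keys p \<subseteq> S"
  shows "poly_derivation \<psi> p = (\<Sum>M\<in>S. \<Sum>a\<in>#M.
     Poly_Mapping.single (M - {#a#}) (Poly_Mapping.lookup p M * \<psi> a))"
  unfolding poly_derivation_def
  using assms by (intro sum.mono_neutral_left) (auto simp: in_keys_iff)

lemma poly_derivation_add: "poly_derivation \<psi> (p + q) = poly_derivation \<psi> p + poly_derivation \<psi> q"
proof -
  let ?S = "Poly_Mapping.keys p \<union> Poly_Mapping.keys q"
  have S: "finite ?S" "Poly_Mapping.keys p \<subseteq> ?S" "Poly_Mapping.keys q \<subseteq> ?S"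
    "Poly_Mapping.keys (p + q) \<subseteq> ?S"
    using keys_add[of p q] by auto
  show ?thesis
    unfolding S(2-4)[THEN poly_derivation_superset[OF S(1)]]
    by (simp add: lookup_add distrib_right single_add sum_mset.distrib sum.distrib)
qed

lemma poly_derivation_single:
  "poly_derivation \<psi> (Poly_Mapping.single M c) = (\<Sum>a\<in>#M. Poly_Mapping.single (M - {#a#}) (c * \<psi> a))"
  by (subst poly_derivation_superset[of "{M}"]) simp_all

lemma poly_derivation_zero [simp]: "poly_derivation \<psi> 0 = 0"
  by (simp add: poly_derivation_def)

text \<open>
  Both sides are biadditive, so it is enough to compare them on monomials, where removing a variable
  from \<open>M + N\<close> means removing it from \<open>M\<close> or from \<open>N\<close>.
\<close>

lemma poly_derivation_mult:
  "poly_derivation \<psi> (p * q) = poly_derivation \<psi> p * q + p * poly_derivation \<psi> q"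
proof (induction p rule: poly_mapping_additive_induct)
  case (single M c)
  show ?case
  proof (induction q rule: poly_mapping_additive_induct)
    case (single N d)
    have "(\<Sum>a\<in>#M. Poly_Mapping.single (M + N - {#a#}) (c * d * \<psi> a))
        = (\<Sum>a\<in>#M. Poly_Mapping.single (M - {#a#}) (c * \<psi> a)) * Poly_Mapping.single N d"
      unfolding sum_mset_distrib_right
      by (intro arg_cong[of _ _ sum_mset] image_mset_cong) (auto simp: mult_single ac_simps)
    moreover have "(\<Sum>a\<in>#N. Poly_Mapping.single (M + N - {#a#}) (c * d * \<psi> a))
        = Poly_Mapping.single M c * (\<Sum>a\<in>#N. Poly_Mapping.single (N - {#a#}) (d * \<psi> a))"
      unfolding sum_mset_distrib_left
      by (intro arg_cong[of _ _ sum_mset] image_mset_cong) (auto simp: mult_single ac_simps)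
    ultimately show ?case
      by (simp add: mult_single poly_derivation_single)
  qed (simp_all add: poly_derivation_add algebra_simps)
qed (simp_all add: poly_derivation_add algebra_simps)

lemma poly_derivation_uminus: "poly_derivation \<psi> (- p) = - poly_derivation \<psi> p"
  by (rule minus_unique[symmetric]) (simp flip: poly_derivation_add)

lemma poly_derivation_diff: "poly_derivation \<psi> (p - q) = poly_derivation \<psi> p - poly_derivation \<psi> q"
  using poly_derivation_add[of \<psi> p "- q"] by (simp add: poly_derivation_uminus)

lemma poly_derivation_gen: "poly_derivation \<psi> (poly_gen a) = poly_const (\<psi> a)"
  by (simp add: poly_gen_def poly_const_def poly_derivation_single)

lemma poly_derivation_const: "poly_derivation \<psi> (poly_const c) = 0"
  by (simp add: poly_const_def poly_derivation_single)

text \<open>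
  The relations of the symmetric algebra have derivative zero precisely because \<open>\<psi>\<close> is linear; by the
  Leibniz rule the ideal that they generate is preserved.
\<close>

lemma poly_derivation_sym_ideal:
  assumes "complex_linear_on UNIV \<psi>" "p \<in> sym_ideal"
  shows "poly_derivation \<psi> p \<in> sym_ideal"
  using assms(2)
proof induction
  case zero
  show ?case by (simp add: sym_ideal.zero)
next
  case (add p q)
  then show ?case by (simp add: poly_derivation_add sym_ideal.add)
next
  case (rel_add p a b)
  have "poly_derivation \<psi> (poly_gen (a + b) - poly_gen a - poly_gen b) = 0"
    using assms(1) by (simp add: poly_derivation_diff poly_derivation_gen complex_linear_on_def
        flip: poly_const_add)
  then show ?case by (simp add: poly_derivation_mult sym_ideal.rel_add)
next
  case (rel_scale p c a)
  have "poly_derivation \<psi> (poly_gen (c *\<^sub>C a) - poly_const c * poly_gen a) = 0"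
    using assms(1) by (simp add: poly_derivation_diff poly_derivation_gen complex_linear_on_def
        poly_derivation_mult poly_derivation_const poly_const_mult)
  then show ?case by (simp add: poly_derivation_mult sym_ideal.rel_scale)
qed

text \<open>The junk value \<open>0\<close> for a function \<open>\<psi>\<close> that is not linear makes the map respect the quotient.\<close>

lift_definition total_derivation ::
  "('a::complex_vector_space \<Rightarrow> complex) \<Rightarrow> 'a sym_alg \<Rightarrow> 'a sym_alg" is
  "\<lambda>\<psi> p. if complex_linear_on UNIV \<psi> then poly_derivation \<psi> p else 0"
  by (auto simp: sym_rel_def poly_derivation_sym_ideal sym_ideal.zero simp flip: poly_derivation_diff)

lemma sym_rel_eqI: "p = q \<Longrightarrow> sym_rel p q"
  by (simp add: sym_rel_def sym_ideal.zero)

lemma scaleC_mult_left: "(c *\<^sub>C v) * w = c *\<^sub>C (v * w :: 'a::complex_vector_space sym_alg)"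
  by transfer (rule sym_rel_eqI, simp add: mult.assoc)

lemma scaleC_mult_right: "v * (c *\<^sub>C w) = c *\<^sub>C (v * w :: 'a::complex_vector_space sym_alg)"
  by transfer (rule sym_rel_eqI, simp add: mult.left_commute)

context
  fixes \<psi> :: "'a::complex_vector_space \<Rightarrow> complex"
  assumes \<psi>: "complex_linear_on UNIV \<psi>"
begin

lemma total_derivation_add: "total_derivation \<psi> (v + w) = total_derivation \<psi> v + total_derivation \<psi> w"
  using \<psi> by transfer (rule sym_rel_eqI, simp add: poly_derivation_add)

lemma total_derivation_mult:
  "total_derivation \<psi> (v * w) = total_derivation \<psi> v * w + v * total_derivation \<psi> w"
  using \<psi> by transfer (rule sym_rel_eqI, simp add: poly_derivation_mult)

lemma total_derivation_scaleC: "total_derivation \<psi> (c *\<^sub>C v) = c *\<^sub>C total_derivation \<psi> v"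
  using \<psi> by transfer (rule sym_rel_eqI, simp add: poly_derivation_mult poly_derivation_const)

lemma total_derivation_gen: "total_derivation \<psi> (sym_gen a) = \<psi> a *\<^sub>C 1"
  using \<psi> by transfer (rule sym_rel_eqI, simp add: poly_derivation_gen)

lemma total_derivation_one: "total_derivation \<psi> 1 = 0"
  using total_derivation_mult[of 1 1] by simp

lemma total_derivation_prod:
  assumes "finite I"
  shows "total_derivation \<psi> (\<Prod>i\<in>I. sym_gen (f i)) = (\<Sum>b\<in>I. \<psi> (f b) *\<^sub>C (\<Prod>i\<in>I - {b}. sym_gen (f i)))"
  using assms
proof induction
  case empty
  show ?case by (simp add: total_derivation_one)
next
  case (insert j I)
  have "(\<Prod>i\<in>insert j I - {b}. sym_gen (f i)) = sym_gen (f j) * (\<Prod>i\<in>I - {b}. sym_gen (f i))" if "b \<in> I" for b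
    using insert that by (subst insert_Diff_if) auto
  moreover have "insert j I - {j} = I" using insert by auto
  ultimately show ?case using insert
    by (simp add: total_derivation_mult total_derivation_gen scaleC_mult_left scaleC_mult_right
        sum_distrib_left)
qed

end

section \<open>Iterated contraction and permanents\<close>

text \<open>The constant term; it is well defined because the relations have none.\<close>

lift_definition augmentation :: "'a::complex_vector_space sym_alg \<Rightarrow> complex" is
  "\<lambda>p. Poly_Mapping.lookup p {#}"
  using sym_ideal_lookup_empty by (fastforce simp: sym_rel_def lookup_minus)

lemma augmentation_add: "augmentation (v + w) = augmentation v + augmentation w"
  by transfer (simp add: lookup_add)

lemma augmentation_one: "augmentation 1 = 1"
  by transfer (simp add: lookup_one)

lemma lookup_const_times: "Poly_Mapping.lookup (poly_const c * p) {#} = c * Poly_Mapping.lookup p {#}"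
proof (induction p rule: poly_mapping_additive_induct)
  case (single k d)
  show ?case by (simp add: poly_const_def mult_single lookup_single when_def)
qed (simp_all add: distrib_left lookup_add)

lemma augmentation_scaleC: "augmentation (c *\<^sub>C v) = c * augmentation v"
  by transfer (rule lookup_const_times)

lemma augmentation_gen_mult: "augmentation (sym_gen a * v) = 0"
  by transfer (subst mult.commute, rule lookup_times_empty, simp add: poly_gen_def lookup_single)

fun sym_contract :: "(nat \<Rightarrow> 'a::complex_vector_space \<Rightarrow> complex) \<Rightarrow> nat \<Rightarrow> 'a sym_alg \<Rightarrow> complex" where
  "sym_contract \<psi> 0 v = augmentation v"
| "sym_contract \<psi> (Suc m) v = sym_contract \<psi> m (total_derivation (\<psi> m) v)"

lemma sym_contract_add:
  assumes "\<And>i. i < m \<Longrightarrow> complex_linear_on UNIV (\<psi> i)"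
  shows "sym_contract \<psi> m (v + w) = sym_contract \<psi> m v + sym_contract \<psi> m w"
  using assms by (induction m arbitrary: v w) (auto simp: augmentation_add total_derivation_add)

lemma sym_contract_scaleC:
  assumes "\<And>i. i < m \<Longrightarrow> complex_linear_on UNIV (\<psi> i)"
  shows "sym_contract \<psi> m (c *\<^sub>C v) = c * sym_contract \<psi> m v"
  using assms by (induction m arbitrary: v) (auto simp: augmentation_scaleC total_derivation_scaleC)

lemma sym_contract_sum:
  assumes "\<And>i. i < m \<Longrightarrow> complex_linear_on UNIV (\<psi> i)"
  shows "sym_contract \<psi> m (\<Sum>b\<in>B. f b) = (\<Sum>b\<in>B. sym_contract \<psi> m (f b))"
proof -
  have "sym_contract \<psi> m 0 = 0" using sym_contract_scaleC[OF assms, where c=0 and v=0] by simp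
  then show ?thesis
    by (induction B rule: infinite_finite_induct) (simp_all add: sym_contract_add[OF assms])
qed

text \<open>
  Differentiating a product of generators along \<open>\<psi> m\<close> first is the Laplace expansion of a permanent along its
  last row: the factor \<open>b\<close> is removed, and the remaining ones are enumerated by putting the
  last factor in the place of \<open>b\<close>. This matches the decomposition of a permutation as a transposition
  after a permutation that fixes \<open>m\<close>.
\<close>

lemma sym_contract_prod:
  assumes "\<And>i. i < m \<Longrightarrow> complex_linear_on UNIV (\<psi> i)"
  shows "sym_contract \<psi> m (\<Prod>i<n. sym_gen (f i)) =
    (if n = m then \<Sum>\<sigma> | \<sigma> permutes {..<m}. \<Prod>i<m. \<psi> i (f (\<sigma> i)) else 0)"
  using assms
proof (induction m arbitrary: n f)
  case 0
  show ?case
  proof (cases n)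
    case 0
    then show ?thesis by (simp add: augmentation_one)
  next
    case (Suc n')
    then show ?thesis by (simp add: augmentation_gen_mult mult.commute)
  qed
next
  case (Suc m)
  have lin: "complex_linear_on UNIV (\<psi> m)" and lin': "\<And>i. i < m \<Longrightarrow> complex_linear_on UNIV (\<psi> i)"
    using Suc.prems by auto
  show ?case
  proof (cases n)
    case 0
    then show ?thesis using sym_contract_sum[OF lin', where B="{}"]
      by (simp add: total_derivation_one[OF lin])
  next
    case (Suc k)
    have swap: "(\<Prod>i\<in>{..<Suc k} - {b}. sym_gen (f i)) = (\<Prod>i<k. sym_gen (f (Transposition.transpose k b i)))"
      if "b < Suc k" for b
    proof (rule prod.reindex_bij_betw[symmetric])
      have "bij_betw (Transposition.transpose k b) ({..<Suc k} - {k}) (Transposition.transpose k b ` ({..<Suc k} - {k}))"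
        by (intro bij_betw_imageI inj_onI refl) (metis transpose_involutory)
      moreover have "{..<Suc k} - {k} = {..<k}" by auto
      moreover have "Transposition.transpose k b ` ({..<Suc k} - {k}) = {..<Suc k} - {b}"
        using that by (auto simp: image_set_diff bij_is_inj Transposition.transpose_def image_iff)
      ultimately show "bij_betw (Transposition.transpose k b) {..<k} ({..<Suc k} - {b})" by simp
    qed
    have "sym_contract \<psi> (Suc m) (\<Prod>i<n. sym_gen (f i))
       = (\<Sum>b<Suc k. \<psi> m (f b) * sym_contract \<psi> m (\<Prod>i<k. sym_gen (f (Transposition.transpose k b i))))"
      using swap by (simp add: Suc total_derivation_prod[OF lin] sym_contract_sum[OF lin'] sym_contract_scaleC[OF lin']
          del: sum.lessThan_Suc prod.lessThan_Suc)
    also have "\<dots> = (if n = Suc m then \<Sum>b<Suc m. \<Sum>q | q permutes {..<m}.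
         \<psi> m (f b) * (\<Prod>i<m. \<psi> i (f (Transposition.transpose m b (q i)))) else 0)"
      using Suc by (simp add: Suc.IH[OF lin'] sum_distrib_left)
    also have "\<dots> = (if n = Suc m then \<Sum>\<sigma> | \<sigma> permutes {..<Suc m}. \<Prod>i<Suc m. \<psi> i (f (\<sigma> i)) else 0)"
    proof -
      have fix_m: "q m = m" if "q permutes {..<m}" for q :: "nat \<Rightarrow> nat"
        using that by (simp add: permutes_not_in)
      show ?thesis
        unfolding lessThan_Suc
        by (subst sum_over_permutations_insert) (auto intro!: sum.cong simp: fix_m mult_ac)
    qed
    finally show ?thesis by simp
  qed
qed

section \<open>The derivation and the evaluation on a subalgebra\<close>

text \<open>
  Evaluations of components are specified on products of generators only, so their uniqueness requires
  that such products span the subalgebra.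
\<close>

inductive_set monomial_span :: "'a::complex_vector_space set \<Rightarrow> 'a sym_alg set" for A where
  monomial: "set as \<subseteq> A \<Longrightarrow> c *\<^sub>C prod_list (map sym_gen as) \<in> monomial_span A"
| add: "v \<in> monomial_span A \<Longrightarrow> w \<in> monomial_span A \<Longrightarrow> v + w \<in> monomial_span A"

lemma monomial_span_scaleC: "v \<in> monomial_span A \<Longrightarrow> c *\<^sub>C v \<in> monomial_span A"
  by (induction rule: monomial_span.induct)
    (auto simp: scaleC_add_right scaleC_scaleC intro: monomial_span.intros)

lemma monomial_span_mult:
  assumes "v \<in> monomial_span A" "w \<in> monomial_span A"
  shows "v * w \<in> monomial_span A"
  using assms(1)
proof induction
  case (monomial as c)
  note as = this
  show ?case using assms(2)
  proof induction
    case (monomial bs d)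
    have "c *\<^sub>C prod_list (map sym_gen as) * d *\<^sub>C prod_list (map sym_gen bs)
        = (c * d) *\<^sub>C prod_list (map sym_gen (as @ bs))"
      by (simp add: scaleC_mult_left scaleC_mult_right scaleC_scaleC mult.commute)
    then show ?case using as monomial monomial_span.monomial[of "as @ bs" A "c * d"] by simp
  qed (simp add: distrib_left monomial_span.add)
qed (simp add: distrib_right monomial_span.add)

lemma Sym_subset_monomial_span: "v \<in> Sym A \<Longrightarrow> v \<in> monomial_span A"
proof (induction rule: Sym.induct)
  case one
  show ?case using monomial_span.monomial[of "[]" A 1] by (simp add: scaleC_one)
next
  case (gen a)
  then show ?case using monomial_span.monomial[of "[a]" A 1] by (simp add: scaleC_one)
qed (simp_all add: monomial_span_scaleC monomial_span_mult monomial_span.add)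

lemma Sym_prod_list: "set as \<subseteq> A \<Longrightarrow> prod_list (map sym_gen as) \<in> Sym A"
  by (induction as) (auto intro: Sym.intros)

lemma Sym_zero: "0 \<in> Sym A"
  using Sym.scale[OF Sym.one, of 0 A] by simp

lemma Sym_mono: "v \<in> Sym A \<Longrightarrow> A \<subseteq> B \<Longrightarrow> v \<in> Sym B"
  by (induction rule: Sym.induct) (auto intro: Sym.intros)

text \<open>
  Finiteness is what makes a Zariski neighbourhood possible: only finitely many forms, hence finitely
  many poles, are involved in a vector.
\<close>

lemma Sym_finite_support:
  assumes "v \<in> Sym A"
  obtains A' where "finite A'" "A' \<subseteq> A" "v \<in> Sym A'"
proof -
  have "\<exists>A'. finite A' \<and> A' \<subseteq> A \<and> v \<in> Sym A'"
    using assms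
  proof induction
    case one
    show ?case by (auto intro: exI[of _ "{}"] Sym.intros)
  next
    case (gen a)
    then show ?case by (auto intro!: exI[of _ "{a}"] Sym.intros)
  next
    case (add v w)
    then obtain A1 A2 where "finite A1" "A1 \<subseteq> A" "v \<in> Sym A1" "finite A2" "A2 \<subseteq> A" "w \<in> Sym A2"
      by blast
    then show ?case by (intro exI[of _ "A1 \<union> A2"])
      (simp add: Sym.add Sym_mono[of v A1 "A1 \<union> A2"] Sym_mono[of w A2 "A1 \<union> A2"])
  next
    case (mult v w)
    then obtain A1 A2 where "finite A1" "A1 \<subseteq> A" "v \<in> Sym A1" "finite A2" "A2 \<subseteq> A" "w \<in> Sym A2"
      by blast
    then show ?case by (intro exI[of _ "A1 \<union> A2"])
      (simp add: Sym.mult Sym_mono[of v A1 "A1 \<union> A2"] Sym_mono[of w A2 "A1 \<union> A2"])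
  qed (auto intro: Sym.intros)
  then show ?thesis using that by blast
qed

lemma sym_derivation_eq_total:
  assumes \<psi>: "complex_linear_on UNIV \<psi>" and ext: "\<And>a. a \<in> A \<Longrightarrow> \<psi> a = \<phi> a"
  shows "sym_derivation A \<phi> = (\<lambda>v. if v \<in> Sym A then total_derivation \<psi> v else 0)"
  unfolding sym_derivation_def
proof (rule the_equality, safe)
  show "(if 1 \<in> Sym A then total_derivation \<psi> 1 else 0) = 0"
    by (simp add: total_derivation_one[OF \<psi>])
next
  fix D assume one: "D 1 = 0" and gen: "\<forall>a\<in>A. D (sym_gen a) = \<phi> a *\<^sub>C 1"
    and add: "\<forall>v\<in>Sym A. \<forall>w\<in>Sym A. D (v + w) = D v + D w"
    and scale: "\<forall>c. \<forall>v\<in>Sym A. D (c *\<^sub>C v) = c *\<^sub>C D v"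
    and mult: "\<forall>v\<in>Sym A. \<forall>w\<in>Sym A. D (v * w) = D v * w + v * D w"
    and out: "\<forall>v. v \<notin> Sym A \<longrightarrow> D v = 0"
  have "D v = total_derivation \<psi> v" if "v \<in> Sym A" for v
    using that
    by (induction rule: Sym.induct)
      (simp_all add: one gen add scale mult ext total_derivation_one[OF \<psi>] total_derivation_gen[OF \<psi>]
        total_derivation_add[OF \<psi>] total_derivation_mult[OF \<psi>] total_derivation_scaleC[OF \<psi>])
  then show "D = (\<lambda>v. if v \<in> Sym A then total_derivation \<psi> v else 0)"
    using out by auto
qed (auto simp: ext total_derivation_gen[OF \<psi>] total_derivation_add[OF \<psi>]
    total_derivation_mult[OF \<psi>] total_derivation_scaleC[OF \<psi>] Sym.intros)

lemma
  assumes "complex_linear_on A \<phi>"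
  shows sym_derivation_one: "sym_derivation A \<phi> 1 = 0"
    and sym_derivation_gen: "a \<in> A \<Longrightarrow> sym_derivation A \<phi> (sym_gen a) = \<phi> a *\<^sub>C 1"
    and sym_derivation_add: "v \<in> Sym A \<Longrightarrow> w \<in> Sym A \<Longrightarrow>
      sym_derivation A \<phi> (v + w) = sym_derivation A \<phi> v + sym_derivation A \<phi> w"
    and sym_derivation_scaleC: "v \<in> Sym A \<Longrightarrow> sym_derivation A \<phi> (c *\<^sub>C v) = c *\<^sub>C sym_derivation A \<phi> v"
    and sym_derivation_mult: "v \<in> Sym A \<Longrightarrow> w \<in> Sym A \<Longrightarrow>
      sym_derivation A \<phi> (v * w) = sym_derivation A \<phi> v * w + v * sym_derivation A \<phi> w"
proof -
  obtain \<psi> where \<psi>: "complex_linear_on UNIV \<psi>" "\<And>a. a \<in> A \<Longrightarrow> \<psi> a = \<phi> a"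
    using complex_linear_extend[OF assms] by blast
  note [simp] = sym_derivation_eq_total[OF \<psi>] Sym.intros total_derivation_one[OF \<psi>(1)]
    total_derivation_gen[OF \<psi>(1)] \<psi>(2)
    total_derivation_add[OF \<psi>(1)] total_derivation_mult[OF \<psi>(1)] total_derivation_scaleC[OF \<psi>(1)]
  show "sym_derivation A \<phi> 1 = 0"
    and "a \<in> A \<Longrightarrow> sym_derivation A \<phi> (sym_gen a) = \<phi> a *\<^sub>C 1"
    and "v \<in> Sym A \<Longrightarrow> w \<in> Sym A \<Longrightarrow>
      sym_derivation A \<phi> (v + w) = sym_derivation A \<phi> v + sym_derivation A \<phi> w"
    and "v \<in> Sym A \<Longrightarrow> sym_derivation A \<phi> (c *\<^sub>C v) = c *\<^sub>C sym_derivation A \<phi> v"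
    and "v \<in> Sym A \<Longrightarrow> w \<in> Sym A \<Longrightarrow>
      sym_derivation A \<phi> (v * w) = sym_derivation A \<phi> v * w + v * sym_derivation A \<phi> w"
    by simp_all
qed

text \<open>
  With \<open>A'\<close> fixed and \<open>A\<close> varying with a point, derivations at different points act on one and the same
  subalgebra, so that they can be composed.
\<close>

lemma sym_derivation_Sym:
  assumes "complex_linear_on A \<phi>" "A' \<subseteq> A" "v \<in> Sym A'"
  shows "sym_derivation A \<phi> v \<in> Sym A'"
  using assms(3)
proof induction
  case one
  show ?case by (simp add: sym_derivation_one[OF assms(1)] Sym_zero)
next
  case (gen a)
  then show ?case using assms(2) by (simp add: sym_derivation_gen[OF assms(1)] subsetD Sym.intros)
qed (simp_all add: Sym_mono[OF _ assms(2)] sym_derivation_add[OF assms(1)]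
    sym_derivation_scaleC[OF assms(1)] sym_derivation_mult[OF assms(1)] Sym.intros)

lemma sym_eval_eq_contract:
  assumes \<psi>: "\<And>i. i < length \<phi>s \<Longrightarrow> complex_linear_on UNIV (\<psi> i)"
    and ext: "\<And>i a. i < length \<phi>s \<Longrightarrow> a \<in> A \<Longrightarrow> \<psi> i a = (\<phi>s ! i) a"
  shows "sym_eval A \<phi>s = (\<lambda>v. if v \<in> Sym A then sym_contract \<psi> (length \<phi>s) v else 0)"
proof -
  let ?m = "length \<phi>s"
  have prod: "sym_contract \<psi> ?m (prod_list (map sym_gen as)) =
      (if length as = ?m
       then \<Sum>\<sigma> | \<sigma> permutes {..<?m}. \<Prod>i<?m. (\<phi>s ! i) (as ! \<sigma> i) else 0)"
    if "set as \<subseteq> A" for as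
  proof -
    have "prod_list (map sym_gen as) = (\<Prod>i<length as. sym_gen (as ! i))"
      by (simp add: prod.list_conv_set_nth atLeast0LessThan)
    moreover have "\<psi> i (as ! \<sigma> i) = (\<phi>s ! i) (as ! \<sigma> i)"
      if "\<sigma> permutes {..<?m}" "length as = ?m" "i < ?m" for \<sigma> i
      using that permutes_in_image[OF that(1), of i] \<open>set as \<subseteq> A\<close> by (intro ext) auto
    ultimately show ?thesis by (simp add: sym_contract_prod[OF \<psi>])
  qed
  show ?thesis
    unfolding sym_eval_def
  proof (rule the_equality, safe)
    fix as assume "set as \<subseteq> A"
    then show "(if prod_list (map sym_gen as) \<in> Sym A
         then sym_contract \<psi> ?m (prod_list (map sym_gen as)) else 0) =
       (if length as = ?m
        then \<Sum>\<sigma> | \<sigma> permutes {..<?m}. \<Prod>i<?m. (\<phi>s ! i) (as ! \<sigma> i) else 0)"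
      by (simp only: prod Sym_prod_list if_True)
  next
    fix L assume L: "\<forall>as. set as \<subseteq> A \<longrightarrow> L (prod_list (map sym_gen as)) =
        (if length as = ?m
         then \<Sum>\<sigma> | \<sigma> permutes {..<?m}. \<Prod>i<?m. (\<phi>s ! i) (as ! \<sigma> i) else 0)"
      and Ladd: "\<forall>v\<in>Sym A. \<forall>w\<in>Sym A. L (v + w) = L v + L w"
      and scale: "\<forall>c. \<forall>v\<in>Sym A. L (c *\<^sub>C v) = c * L v"
      and out: "\<forall>v. v \<notin> Sym A \<longrightarrow> L v = 0"
    have "v \<in> Sym A \<and> L v = sym_contract \<psi> ?m v" if "v \<in> monomial_span A" for v
      using that
    proof induction
      case (monomial as c)
      have "L (c *\<^sub>C prod_list (map sym_gen as)) = c * sym_contract \<psi> ?m (prod_list (map sym_gen as))"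
        using scale L monomial by (simp only: prod Sym_prod_list)
      then show ?case using monomial by (simp add: sym_contract_scaleC[OF \<psi>] Sym.scale Sym_prod_list)
    next
      case (add v w)
      then show ?case using Ladd by (simp add: sym_contract_add[OF \<psi>] Sym.add)
    qed
    then show "L = (\<lambda>v. if v \<in> Sym A then sym_contract \<psi> ?m v else 0)"
      using out Sym_subset_monomial_span by fastforce
  qed (simp_all add: Sym.intros sym_contract_add[OF \<psi>] sym_contract_scaleC[OF \<psi>])
qed

lemma
  assumes "\<And>\<phi>. \<phi> \<in> set \<phi>s \<Longrightarrow> complex_linear_on A \<phi>"
  shows sym_eval_prod_list: "set as \<subseteq> A \<Longrightarrow> sym_eval A \<phi>s (prod_list (map sym_gen as)) =
        (if length as = length \<phi>s
         then \<Sum>\<sigma> | \<sigma> permutes {..<length \<phi>s}. \<Prod>i<length \<phi>s. (\<phi>s ! i) (as ! \<sigma> i) else 0)"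
    and sym_eval_add: "v \<in> Sym A \<Longrightarrow> w \<in> Sym A \<Longrightarrow>
      sym_eval A \<phi>s (v + w) = sym_eval A \<phi>s v + sym_eval A \<phi>s w"
    and sym_eval_scaleC: "v \<in> Sym A \<Longrightarrow> sym_eval A \<phi>s (c *\<^sub>C v) = c * sym_eval A \<phi>s v"
proof -
  have "\<exists>\<psi>. complex_linear_on UNIV \<psi> \<and> (\<forall>a\<in>A. \<psi> a = (\<phi>s ! i) a)" if "i < length \<phi>s" for i
    using complex_linear_extend[OF assms[OF nth_mem[OF that]]] by metis
  then obtain \<psi> where \<psi>: "\<And>i. i < length \<phi>s \<Longrightarrow> complex_linear_on UNIV (\<psi> i)"
     "\<And>i a. i < length \<phi>s \<Longrightarrow> a \<in> A \<Longrightarrow> \<psi> i a = (\<phi>s ! i) a"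
    by metis
  note eq = sym_eval_eq_contract[OF \<psi>, simplified]
  show "v \<in> Sym A \<Longrightarrow> w \<in> Sym A \<Longrightarrow> sym_eval A \<phi>s (v + w) = sym_eval A \<phi>s v + sym_eval A \<phi>s w"
    and "v \<in> Sym A \<Longrightarrow> sym_eval A \<phi>s (c *\<^sub>C v) = c * sym_eval A \<phi>s v"
    by (simp_all add: eq Sym.intros sym_contract_add[OF \<psi>(1)] sym_contract_scaleC[OF \<psi>(1)])
  assume as: "set as \<subseteq> A"
  have "prod_list (map sym_gen as) = (\<Prod>i<length as. sym_gen (as ! i))"
    by (simp add: prod.list_conv_set_nth atLeast0LessThan)
  moreover have "\<psi> i (as ! \<sigma> i) = (\<phi>s ! i) (as ! \<sigma> i)"
    if "\<sigma> permutes {..<length \<phi>s}" "length as = length \<phi>s" "i < length \<phi>s" for \<sigma> i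
    using that permutes_in_image[OF that(1), of i] as by (intro \<psi>) auto
  ultimately show "sym_eval A \<phi>s (prod_list (map sym_gen as)) =
        (if length as = length \<phi>s
         then \<Sum>\<sigma> | \<sigma> permutes {..<length \<phi>s}. \<Prod>i<length \<phi>s. (\<phi>s ! i) (as ! \<sigma> i) else 0)"
    using Sym_prod_list[OF as] by (simp add: eq sym_contract_prod[OF \<psi>(1)])
qed

section \<open>Rationality from polynomial growth\<close>

lemma laurent_power_limit:
  fixes g :: "complex \<Rightarrow> complex"
  assumes "g has_laurent_expansion F" "- int n \<le> fls_subdegree F"
  shows "((\<lambda>t. t ^ n * g t) \<longlongrightarrow> fls_nth F (- int n)) (at 0)"
proof -
  have G: "(\<lambda>t. t ^ n * g t) has_laurent_expansion fls_X ^ n * F"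
    by (intro laurent_expansion_intros assms(1))
  have "fls_X ^ n * F = fls_shift (- int n) F"
    by (simp add: fls_X_power_times_conv_shift)
  then have "fls_subdegree (fls_X ^ n * F) \<ge> 0" "fls_nth (fls_X ^ n * F) 0 = fls_nth F (- int n)"
    using assms(2) by (cases "F = 0"; simp)+
  with has_laurent_expansion_imp_tendsto_0[OF G] show ?thesis by simp
qed

lemma meromorphic_power_limit:
  fixes g :: "complex \<Rightarrow> complex"
  assumes "g meromorphic_on {a}"
  obtains n L where "((\<lambda>x. (x - a) ^ n * g x) \<longlongrightarrow> L) (at a)"
proof -
  obtain F where F: "(\<lambda>t. g (a + t)) has_laurent_expansion F"
    using assms by (auto simp: meromorphic_on_def)
  have "((\<lambda>t. t ^ nat (- fls_subdegree F) * g (a + t)) \<longlongrightarrow> fls_nth F (- int (nat (- fls_subdegree F)))) (at 0)"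
    by (rule laurent_power_limit[OF F]) simp
  then have "((\<lambda>x. (x - a) ^ nat (- fls_subdegree F) * g x) \<longlongrightarrow> fls_nth F (- int (nat (- fls_subdegree F)))) (at a)"
    by (simp add: at_to_0[of a] filterlim_filtermap add.commute)
  then show ?thesis using that by blast
qed

lemma simple_pole_limit:
  fixes g :: "complex \<Rightarrow> complex"
  assumes "g meromorphic_on {0}" "is_pole g 0" "zorder g 0 = - 1"
  obtains c where "c \<noteq> 0" "((\<lambda>t. t * g t) \<longlongrightarrow> c) (at 0)"
proof -
  obtain F where F: "g has_laurent_expansion F"
    using assms(1) by (auto simp: meromorphic_on_def)
  have neg: "fls_subdegree F < 0" using is_pole_0_imp_neg_fls_subdegree[OF F] assms(2) by simp
  then have "F \<noteq> 0" by auto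
  then have "fls_subdegree F = - 1" using has_laurent_expansion_zorder_0[OF F] assms(3) by simp
  then have "fls_nth F (- 1) \<noteq> 0" using \<open>F \<noteq> 0\<close> by (metis nth_fls_subdegree_nonzero)
  moreover have "((\<lambda>t. t * g t) \<longlongrightarrow> fls_nth F (- 1)) (at 0)"
    using laurent_power_limit[OF F, of 1] \<open>fls_subdegree F = - 1\<close> by simp
  ultimately show ?thesis using that by blast
qed

lemma entire_polynomial_growth:
  fixes f :: "complex \<Rightarrow> complex"
  assumes "f holomorphic_on UNIV" "((\<lambda>t. t ^ n * f (1 / t)) \<longlongrightarrow> L) (at 0)"
  obtains p where "degree p \<le> n" "\<And>x. f x = poly p x"
proof -
  have "eventually (\<lambda>t. dist (t ^ n * f (1 / t)) L < 1) (at 0)"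
    using assms(2) tendstoD zero_less_one by blast
  then obtain d where d: "d > 0" "\<And>t. t \<noteq> 0 \<Longrightarrow> norm t < d \<Longrightarrow> dist (t ^ n * f (1 / t)) L < 1"
    by (auto simp: eventually_at dist_norm)
  have "f x = (\<Sum>k\<le>n. (deriv ^^ k) f 0 / fact k * x ^ k)" for x
  proof (rule Liouville_polynomial[OF assms(1), of "2 / d" "norm L + 1"])
    fix z :: complex assume z: "2 / d \<le> norm z"
    then have "norm z > 0" using d(1) by (smt (verit) divide_pos_pos)
    moreover from this have "norm (1 / z) < d"
      using z d(1) by (simp add: norm_divide field_simps)
    ultimately have "norm ((1 / z) ^ n * f (1 / (1 / z)) - L) < 1"
      using d(2)[of "1 / z"] by (auto simp: dist_norm)
    then have "norm ((1 / z) ^ n * f z) \<le> norm L + 1"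
      using norm_triangle_ineq2[of "(1 / z) ^ n * f z" L] by simp
    then show "norm (f z) \<le> (norm L + 1) * norm z ^ n"
      using \<open>norm z > 0\<close> by (simp add: norm_mult norm_power norm_divide power_divide divide_simps)
  qed
  then have "f x = poly (\<Sum>k\<le>n. monom ((deriv ^^ k) f 0 / fact k) k) x" for x
    by (simp add: poly_sum poly_monom)
  moreover have "degree (\<Sum>k\<le>n. monom ((deriv ^^ k) f 0 / fact k) k) \<le> n"
    by (intro degree_sum_le) (auto intro: order.trans[OF degree_monom_le])
  ultimately show ?thesis using that by blast
qed

lemma entire_linear_growth:
  fixes f :: "complex \<Rightarrow> complex"
  assumes "f holomorphic_on UNIV" "((\<lambda>t. t * f (1 / t)) \<longlongrightarrow> L) (at 0)"
  obtains \<alpha> where "\<And>x. f x = \<alpha> + L * x"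
proof -
  have "((\<lambda>t. t ^ 1 * f (1 / t)) \<longlongrightarrow> L) (at 0)" using assms(2) by simp
  then obtain P where P: "degree P \<le> 1" "\<And>x. f x = poly P x"
    using entire_polynomial_growth[OF assms(1)] by metis
  define \<alpha> \<beta> where "\<alpha> = coeff P 0" and "\<beta> = coeff P 1"
  have f_eq: "f x = \<alpha> + \<beta> * x" for x
  proof -
    have "P = [:\<alpha>, \<beta>:]"
      using P(1) by (intro poly_eqI) (auto simp: coeff_pCons coeff_eq_0 \<alpha>_def \<beta>_def split: nat.split)
    then show ?thesis by (simp add: P(2))
  qed
  have "((\<lambda>t. \<alpha> * t + \<beta>) \<longlongrightarrow> \<alpha> * 0 + \<beta>) (at 0)" by (intro tendsto_intros)
  then have "((\<lambda>t. t * f (1 / t)) \<longlongrightarrow> \<alpha> * 0 + \<beta>) (at 0)"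
    by (rule Lim_transform_eventually) (auto simp: eventually_at_filter f_eq field_simps)
  then have "\<alpha> * 0 + \<beta> = L" using assms(2) by (rule tendsto_unique[OF at_neq_bot])
  then have "\<beta> = L" by simp
  then show ?thesis using f_eq that by blast
qed

text \<open>
  The singularity at infinity is isolated, which confines the others to a disc; they have no limit
  point there.
\<close>

lemma meromorphic_at_infinity_finite_singularities:
  fixes f :: "complex \<Rightarrow> complex"
  assumes "f meromorphic_on UNIV" "(\<lambda>t. f (1 / t)) meromorphic_on {0}"
  shows "finite {x. \<not> f analytic_on {x}}"
proof -
  obtain r where r: "r > 0" "(\<lambda>t. f (1 / t)) analytic_on ball 0 r - {0}"
    using assms(2) by (auto simp: meromorphic_at_iff isolated_singularity_at_def)
  have "f analytic_on {x}" if x: "norm x > 1 / r" for x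
  proof -
    have "x \<noteq> 0" using x r(1) by auto
    then have "norm (1 / x) < r" using x r(1) by (simp add: norm_divide field_simps)
    then have "(\<lambda>t. f (1 / t)) analytic_on {1 / x}"
      using \<open>x \<noteq> 0\<close> by (intro analytic_on_subset[OF r(2)]) auto
    then have "((\<lambda>t. f (1 / t)) \<circ> (\<lambda>y. 1 / y)) analytic_on {x}"
      using \<open>x \<noteq> 0\<close> by (intro analytic_on_compose) (auto intro!: analytic_intros)
    then show ?thesis by (simp add: o_def)
  qed
  then have sub: "{x. \<not> f analytic_on {x}} \<subseteq> cball 0 (1 / r)" by (force simp: not_le)
  show ?thesis
  proof (rule ccontr)
    assume "infinite {x. \<not> f analytic_on {x}}"
    then obtain x where "x islimpt {x. \<not> f analytic_on {x}}"
      using Heine_Borel_imp_Bolzano_Weierstrass[OF compact_cball _ sub] by blast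
    then show False using meromorphic_on_imp_not_islimpt_singularities[OF assms(1), of x] by simp
  qed
qed

text \<open>
  Multiplying by a polynomial \<open>q\<close> clears the finitely many poles. What remains is an entire function
  with at most a pole at infinity, which is a polynomial by Liouville's theorem.
\<close>

lemma meromorphic_imp_rational:
  fixes f :: "complex \<Rightarrow> complex"
  assumes "f meromorphic_on UNIV" "(\<lambda>t. f (1 / t)) meromorphic_on {0}"
  obtains p q where "q \<noteq> 0" "finite {x. f x \<noteq> poly p x / poly q x}"
proof -
  define S where "S = {x. \<not> f analytic_on {x}}"
  have S: "finite S"
    unfolding S_def using meromorphic_at_infinity_finite_singularities[OF assms] .
  have "\<exists>n L. ((\<lambda>x. (x - a) ^ n * f x) \<longlongrightarrow> L) (at a)" for a
  proof -
    have "f meromorphic_on {a}" using meromorphic_on_subset[OF assms(1)] by simp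
    then show ?thesis by (metis meromorphic_power_limit)
  qed
  then obtain n L where nL: "\<And>a. ((\<lambda>x. (x - a) ^ n a * f x) \<longlongrightarrow> L a) (at a)"
    by metis
  define q where "q = (\<Prod>a\<in>S. [:- a, 1:] ^ n a)"
  have q: "poly q x = (\<Prod>a\<in>S. (x - a) ^ n a)" for x
    by (simp add: q_def poly_prod)
  have q0: "q \<noteq> 0" using S by (simp add: q_def)
  define h where "h = (\<lambda>x. poly q x * f x)"
  have hm: "h meromorphic_on UNIV"
    unfolding h_def q by (intro meromorphic_intros assms)
  define g where "g = remove_sings h"
  have h_an: "h analytic_on {x}" if "x \<notin> S" for x
    using that unfolding h_def q S_def by (intro analytic_intros) auto
  have gh: "g x = h x" if "x \<notin> S" for x
    unfolding g_def using h_an[OF that] by simp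
  have g_an: "g analytic_on {a}" for a
  proof (cases "a \<in> S")
    case True
    have "((\<lambda>x. (\<Prod>b\<in>S - {a}. (x - b) ^ n b) * ((x - a) ^ n a * f x))
        \<longlongrightarrow> (\<Prod>b\<in>S - {a}. (a - b) ^ n b) * L a) (at a)"
      by (intro tendsto_intros nL)
    also have "(\<lambda>x. (\<Prod>b\<in>S - {a}. (x - b) ^ n b) * ((x - a) ^ n a * f x)) = h"
      unfolding h_def q using S True by (auto simp: prod.remove mult_ac)
    finally have "h \<midarrow>a\<rightarrow> (\<Prod>b\<in>S - {a}. (a - b) ^ n b) * L a" .
    moreover have "isolated_singularity_at h a"
      using meromorphic_on_subset[OF hm, of "{a}"] by (simp add: meromorphic_at_iff)
    ultimately show ?thesis unfolding g_def by (intro remove_sings_analytic_at)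
  next
    case False
    then show ?thesis unfolding g_def by (intro remove_sings_analytic_on h_an)
  qed
  have g_hol: "g holomorphic_on UNIV"
    using g_an analytic_on_analytic_at analytic_imp_holomorphic by blast
  have "(\<lambda>t. poly q (1 / t) * f (1 / t)) meromorphic_on {0}"
    by (intro meromorphic_intros assms(2)) (simp add: poly_altdef, intro meromorphic_intros)
  moreover have "eventually (\<lambda>t. g (1 / t) = poly q (1 / t) * f (1 / t)) (at 0)"
  proof -
    have "finite ((\<lambda>a. 1 / a) ` S)" using S by simp
    then have "eventually (\<lambda>t. t \<notin> (\<lambda>a. 1 / a) ` S) (at 0)"
      using islimpt_finite islimpt_iff_eventually by blast
    then show ?thesis
    proof eventually_elim
      case (elim t)
      then have "1 / t \<notin> S" by (metis div_by_1 divide_divide_eq_right image_eqI mult_1)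
      then show ?case by (simp add: gh h_def)
    qed
  qed
  ultimately have "(\<lambda>t. g (1 / t)) meromorphic_on {0}"
    by (subst meromorphic_on_cong[of "{0}" _ "\<lambda>t. poly q (1 / t) * f (1 / t)" "{0}"]) auto
  then obtain N K where "((\<lambda>t. (t - 0) ^ N * g (1 / t)) \<longlongrightarrow> K) (at 0)"
    using meromorphic_power_limit by metis
  then obtain p where p: "\<And>x. g x = poly p x"
    using entire_polynomial_growth[OF g_hol, of N K] by auto
  have "f x = poly p x / poly q x" if "x \<notin> S" "poly q x \<noteq> 0" for x
    using gh[OF that(1)] that(2) by (simp add: p h_def field_simps)
  then have "{x. f x \<noteq> poly p x / poly q x} \<subseteq> S \<union> {x. poly q x = 0}" by auto
  then have "finite {x. f x \<noteq> poly p x / poly q x}"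
    by (rule finite_subset) (simp add: S poly_roots_finite q0)
  then show ?thesis using that q0 by blast
qed

lemma nicely_meromorphic_shift:
  fixes f :: "complex \<Rightarrow> complex"
  assumes "\<And>a. (\<lambda>t. f (a + t)) nicely_meromorphic_on {0}"
  shows "f nicely_meromorphic_on UNIV"
  unfolding nicely_meromorphic_on_def
proof (intro conjI ballI)
  show "f meromorphic_on UNIV"
    using assms by (auto simp: nicely_meromorphic_on_def meromorphic_on_def)
  fix a
  have "(is_pole (\<lambda>t. f (a + t)) 0 \<and> f a = 0) \<or> (\<lambda>t. f (a + t)) \<midarrow>0\<rightarrow> f a"
    using assms[of a] by (auto simp: nicely_meromorphic_on_def)
  then show "(is_pole f a \<and> f a = 0) \<or> f \<midarrow>a\<rightarrow> f a"
    by (simp add: is_pole_def at_to_0[of a] filterlim_filtermap add.commute)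
qed

section \<open>Coordinates are Moebius transformations\<close>

text \<open>
  Since division by zero yields zero, the formulas also hold at the pole of \<open>u\<close>, where the value is \<open>0\<close>.
\<close>

locale moebius =
  fixes u :: "pline \<Rightarrow> complex" and a b c d :: complex
  assumes det: "a * d - b * c \<noteq> 0"
    and u_affine: "u (Affine x) = (a * x + b) / (c * x + d)"
    and u_infinity: "u AtInfinity = a / c"
    and pole_affine: "pole_at u (Affine x) \<longleftrightarrow> c * x + d = 0"
    and pole_infinity: "pole_at u AtInfinity \<longleftrightarrow> c = 0"

text \<open>
  If the pole is at infinity, the function is entire of linear growth. Otherwise the pole is a point
  \<open>s\<close>, and multiplication by \<open>x - s\<close> gives an entire function, which grows linearly because \<open>u\<close> is
  bounded near infinity.
\<close>

lemma coordinate_imp_moebius: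
  assumes "coordinate u"
  obtains a b c d where "moebius u a b c d"
proof -
  define f where "f = (\<lambda>x. u (Affine x))"
  have mero: "(\<lambda>t. u (chart z t)) nicely_meromorphic_on {0}" for z
    using assms by (simp add: coordinate_def meromorphic_fun_def)
  obtain p where p: "\<And>z. pole_at u z \<longleftrightarrow> z = p" "zorder (\<lambda>t. u (chart p t)) 0 = - 1"
    using assms by (auto simp: coordinate_def)
  have f: "f nicely_meromorphic_on UNIV"
    using mero[of "Affine _"] by (intro nicely_meromorphic_shift) (simp add: f_def)
  have pole_f: "is_pole f x \<longleftrightarrow> pole_at u (Affine x)" for x
    by (simp add: pole_at_def f_def is_pole_shift_0')
  have f_an: "f analytic_on {x}" if "Affine x \<noteq> p" for x
    using nicely_meromorphic_on_imp_analytic_at[OF f, of x] that by (simp add: pole_f p)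
  obtain k where k: "k \<noteq> 0" "((\<lambda>t. t * u (chart p t)) \<longlongrightarrow> k) (at 0)"
  proof (rule simple_pole_limit)
    show "(\<lambda>t. u (chart p t)) meromorphic_on {0}" using mero by (simp add: nicely_meromorphic_on_def)
    show "is_pole (\<lambda>t. u (chart p t)) 0" using p(1)[of p] by (simp add: pole_at_def)
  qed (use p in auto)
  have at_inf: "eventually (\<lambda>t. u (chart AtInfinity t) = f (1 / t)) (at 0)"
    by (auto simp: eventually_at_filter f_def)
  show ?thesis
  proof (cases p)
    case AtInfinity
    have "f holomorphic_on UNIV"
      using f_an AtInfinity analytic_on_analytic_at analytic_imp_holomorphic by blast
    moreover have lim: "((\<lambda>t. t * f (1 / t)) \<longlongrightarrow> k) (at 0)"
    proof (rule Lim_transform_eventually[OF k(2)])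
      show "eventually (\<lambda>t. t * u (chart p t) = t * f (1 / t)) (at 0)"
        using at_inf unfolding AtInfinity by eventually_elim simp
    qed
    ultimately obtain \<alpha> where f_eq: "\<And>x. f x = \<alpha> + k * x"
      using entire_linear_growth by metis
    have "is_pole (\<lambda>t. u (chart AtInfinity t)) 0"
      using p(1)[of AtInfinity] AtInfinity by (simp add: pole_at_def)
    then have "u AtInfinity = 0"
      using is_pole_zero_at_nicely_mero[OF mero[of AtInfinity]] by simp
    then have "moebius u k \<alpha> 0 1"
      using k(1) p(1)[of "Affine _"] p(1)[of AtInfinity] AtInfinity f_eq by unfold_locales (simp_all add: f_def)
    then show ?thesis by (rule that)
  next
    case (Affine s)
    define w where "w = u AtInfinity"
    have "\<not> is_pole (\<lambda>t. u (chart AtInfinity t)) 0"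
      using p(1)[of AtInfinity] Affine by (simp add: pole_at_def)
    then have "((\<lambda>t. u (chart AtInfinity t)) \<longlongrightarrow> w) (at 0)"
      using mero[of AtInfinity] by (auto simp: nicely_meromorphic_on_def w_def)
    then have lim_w: "((\<lambda>t. f (1 / t)) \<longlongrightarrow> w) (at 0)"
      using at_inf by (rule Lim_transform_eventually)
    define g where "g = (\<lambda>x. if x = s then k else (x - s) * f x)"
    have "((\<lambda>t. t * f (s + t)) \<longlongrightarrow> k) (at 0)" using k(2) Affine by (simp add: f_def)
    then have "((\<lambda>x. (x - s) * f x) \<longlongrightarrow> k) (at s)"
      by (simp add: at_to_0[of s] filterlim_filtermap add.commute)
    then have "(g \<longlongrightarrow> k) (at s)"
      by (rule Lim_transform_eventually) (auto simp: g_def eventually_at_filter)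
    then have g_lim: "(g \<longlongrightarrow> g s) (at s)" by (simp add: g_def)
    have g_hol':  "g holomorphic_on UNIV - {s}"
    proof -
      have "f analytic_on UNIV - {s}"
        by (subst analytic_on_analytic_at) (use f_an Affine in simp)
      then have "(\<lambda>x. (x - s) * f x) holomorphic_on UNIV - {s}"
        by (intro analytic_imp_holomorphic analytic_intros)
      then show ?thesis by (rule holomorphic_transform) (simp add: g_def)
    qed
    have g_hol: "g holomorphic_on UNIV"
      by (rule no_isolated_singularity'[OF _ g_hol']) (simp_all add: g_lim)
    have "((\<lambda>t. (1 - s * t) * f (1 / t)) \<longlongrightarrow> (1 - s * 0) * w) (at 0)"
      by (intro tendsto_intros lim_w)
    then have lim_1: "((\<lambda>t. (1 - s * t) * f (1 / t)) \<longlongrightarrow> w) (at 0)" by simp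
    have "eventually (\<lambda>t. (1 - s * t) * f (1 / t) = t * g (1 / t)) (at 0)"
    proof -
      have "((\<lambda>t. s * t) \<longlongrightarrow> s * 0) (at 0)" by (intro tendsto_intros)
      then have "eventually (\<lambda>t. s * t \<noteq> 1) (at 0)"
        by (rule tendsto_imp_eventually_ne) simp
      moreover have "eventually (\<lambda>t. t \<noteq> 0) (at (0::complex))" by (simp add: eventually_at_filter)
      ultimately show ?thesis
      proof eventually_elim
        case (elim t)
        then have "1 / t \<noteq> s" by auto
        then show ?case using elim by (simp add: g_def algebra_simps)
      qed
    qed
    with lim_1 have "((\<lambda>t. t * g (1 / t)) \<longlongrightarrow> w) (at 0)"
      by (rule Lim_transform_eventually)
    then obtain \<alpha> where g_eq: "\<And>x. g x = \<alpha> + w * x"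
      using entire_linear_growth[OF g_hol] by metis
    have f_eq: "f x = (w * x + \<alpha>) / (x - s)" for x
    proof (cases "x = s")
      case True
      have "is_pole f s" using p(1)[of "Affine s"] Affine by (simp add: pole_f)
      then have "f s = 0"
        using is_pole_zero_at_nicely_mero[OF f] by simp
      then show ?thesis by (simp add: True)
    next
      case False
      then show ?thesis using g_eq[of x] by (simp add: g_def field_simps)
    qed
    have "w * s + \<alpha> \<noteq> 0" using g_eq[of s] k(1) by (simp add: g_def add.commute)
    moreover have "w * (- s) - \<alpha> * 1 = - (w * s + \<alpha>)" by simp
    ultimately have "w * (- s) - \<alpha> * 1 \<noteq> 0" by (metis neg_equal_0_iff_equal)
    then have "moebius u w \<alpha> 1 (- s)"
      using p(1)[of "Affine _"] p(1)[of AtInfinity] Affine f_eq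
      by unfold_locales (simp_all only: f_def w_def, simp_all)
    then show ?thesis by (rule that)
  qed
qed

section \<open>Regular forms and their values\<close>

lemma K_reg_iff_limit: "\<alpha> \<in> K_reg z \<longleftrightarrow> (\<exists>L. (local_coeff (dx_coeff \<alpha>) z \<longlongrightarrow> L) (at 0))"
proof -
  have "second_kind (dx_coeff \<alpha>)" using dx_coeff[of \<alpha>] by simp
  then have "not_essential (local_coeff (dx_coeff \<alpha>) z) 0"
    by (auto simp: second_kind_def meromorphic_at_iff)
  moreover have "\<not> is_pole f 0" if "(f \<longlongrightarrow> L) (at 0)" for f :: "complex \<Rightarrow> complex" and L
    using that not_tendsto_and_filterlim_at_infinity[of "at (0::complex)" f]
    by (auto simp: is_pole_def)
  ultimately show ?thesis by (auto simp: K_reg_def not_essential_def)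
qed

lemma K_reg_limit:
  assumes "\<alpha> \<in> K_reg z"
  shows "(local_coeff (dx_coeff \<alpha>) z \<longlongrightarrow> remove_sings (local_coeff (dx_coeff \<alpha>) z) 0) (at 0)"
  using assms remove_sings_eqI unfolding K_reg_iff_limit by blast

text \<open>
  The sum of two forms has its removable singularities removed, so it is the pointwise sum only near,
  and not necessarily at, the given point.
\<close>

lemma dx_coeff_add_local:
  "eventually (\<lambda>t. local_coeff (dx_coeff \<alpha>) z t + local_coeff (dx_coeff \<beta>) z t
      = local_coeff (dx_coeff (\<alpha> + \<beta>)) z t) (at 0)"
proof -
  let ?f = "dx_coeff \<alpha>" and ?g = "dx_coeff \<beta>"
  have sk: "second_kind (\<lambda>x. ?f x + ?g x)"
    using dx_coeff[of \<alpha>] dx_coeff[of \<beta>] by (simp add: second_kind_add)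
  have "dx_coeff (\<alpha> + \<beta>) = remove_sings (\<lambda>x. ?f x + ?g x)" by (rule plus_form.rep_eq)
  then have "eventually (\<lambda>t. local_coeff (dx_coeff (\<alpha> + \<beta>)) z t = local_coeff (\<lambda>x. ?f x + ?g x) z t) (at 0)"
    using eventually_local_coeff_remove_sings[of "\<lambda>x. ?f x + ?g x" z] sk
    by (simp add: second_kind_def)
  then show ?thesis
    by eventually_elim (cases z; simp add: diff_divide_distrib)
qed

lemma value_at_linear: "complex_linear_on (K_reg z) (\<lambda>\<alpha>. value_at u \<alpha> z)"
proof -
  have loc0: "local_coeff (\<lambda>_. 0) z = (\<lambda>_. 0)"
    by (cases z) (auto simp: fun_eq_iff)
  have loc_c: "local_coeff (\<lambda>x. c * f x) z = (\<lambda>t. c * local_coeff f z t)" for c f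
    by (cases z) (auto simp: fun_eq_iff)
  show ?thesis
    unfolding complex_linear_on_def
  proof (intro conjI ballI allI)
    show "0 \<in> K_reg z" by (auto simp: K_reg_iff_limit zero_form.rep_eq loc0)
  next
    fix \<alpha> \<beta> assume "\<alpha> \<in> K_reg z" "\<beta> \<in> K_reg z"
    then have "((\<lambda>t. local_coeff (dx_coeff \<alpha>) z t + local_coeff (dx_coeff \<beta>) z t) \<longlongrightarrow>
        remove_sings (local_coeff (dx_coeff \<alpha>) z) 0 + remove_sings (local_coeff (dx_coeff \<beta>) z) 0) (at 0)"
      by (intro tendsto_add K_reg_limit)
    from Lim_transform_eventually[OF this dx_coeff_add_local]
    show "\<alpha> + \<beta> \<in> K_reg z" and "value_at u (\<alpha> + \<beta>) z = value_at u \<alpha> z + value_at u \<beta> z"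
      by (auto simp: K_reg_iff_limit value_at_def remove_sings_eqI add_divide_distrib)
  next
    fix c \<alpha> assume "\<alpha> \<in> K_reg z"
    then have "((\<lambda>t. c * local_coeff (dx_coeff \<alpha>) z t) \<longlongrightarrow>
        c * remove_sings (local_coeff (dx_coeff \<alpha>) z) 0) (at 0)"
      by (intro tendsto_mult_left K_reg_limit)
    then show "c *\<^sub>C \<alpha> \<in> K_reg z" and "value_at u (c *\<^sub>C \<alpha>) z = c * value_at u \<alpha> z"
      by (auto simp: K_reg_iff_limit value_at_def remove_sings_eqI scaleC_form.rep_eq loc_c)
  qed
qed

lemma dx_coeff_nice: "dx_coeff \<alpha> nicely_meromorphic_on UNIV" "dx_coeff \<alpha> meromorphic_on UNIV"
  using dx_coeff[of \<alpha>] by (auto simp: second_kind_def)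

text \<open>
  The forms \<open>e(z)\<close> are multiples of \<open>dx / (p x + q)\<^sup>2\<close>, where \<open>p = 0\<close> if \<open>z\<close> is the point at infinity. This
  shape is preserved by \<open>t = 1 / x\<close>, so one residue computation serves for all points.
\<close>

lemma residue_const_over_linear_square:
  assumes "p \<noteq> 0 \<or> q \<noteq> 0"
  shows "residue (\<lambda>t. k / (p + q * t)\<^sup>2) 0 = 0"
proof (cases "p = 0")
  case True
  have "residue (\<lambda>t. (k / q\<^sup>2) / t ^ Suc 1) 0 = (deriv ^^ 1) (\<lambda>_. k / q\<^sup>2) 0 / fact 1"
    by (rule residue_holomorphic_over_power'[of UNIV]) auto
  moreover have "(\<lambda>t. (k / q\<^sup>2) / t ^ Suc 1) = (\<lambda>t. k / (p + q * t)\<^sup>2)"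
    using True by (simp add: power2_eq_square mult_ac)
  ultimately show ?thesis by simp
next
  case False
  then have "(\<lambda>t. k / (p + q * t)\<^sup>2) analytic_on {0}"
    by (auto intro!: analytic_intros)
  then obtain A where "open A" "0 \<in> A" "(\<lambda>t. k / (p + q * t)\<^sup>2) holomorphic_on A"
    by (auto simp: analytic_on_holomorphic)
  then show ?thesis by (rule residue_holo)
qed

lemma second_kind_const_over_linear_square:
  assumes "p \<noteq> 0 \<or> q \<noteq> 0"
  shows "second_kind (\<lambda>x. k / (p * x + q)\<^sup>2)"
  unfolding second_kind_def
proof (intro conjI allI)
  show "(\<lambda>x. k / (p * x + q)\<^sup>2) meromorphic_on UNIV" by (intro meromorphic_intros)
  fix z
  have "\<exists>p' q' k'. (p' \<noteq> 0 \<or> q' \<noteq> 0) \<and>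
     eventually (\<lambda>t. k' / (p' + q' * t)\<^sup>2 = local_coeff (\<lambda>x. k / (p * x + q)\<^sup>2) z t) (at 0)"
  proof (cases z)
    case (Affine s)
    have "eventually (\<lambda>t. k / ((p * s + q) + p * t)\<^sup>2 = local_coeff (\<lambda>x. k / (p * x + q)\<^sup>2) z t) (at 0)"
      by (simp add: Affine algebra_simps)
    moreover have "p * s + q \<noteq> 0 \<or> p \<noteq> 0" using assms by auto
    ultimately show ?thesis by blast
  next
    case AtInfinity
    have "- k / (p + q * t)\<^sup>2 = - (k / (p * (1 / t) + q)\<^sup>2) / t\<^sup>2" if "t \<noteq> 0" for t
    proof -
      have "p * (1 / t) + q = (p + q * t) / t" using that by (simp add: field_simps)
      then show ?thesis using that by (simp add: power_divide)
    qed
    then have "eventually (\<lambda>t. - k / (p + q * t)\<^sup>2 = local_coeff (\<lambda>x. k / (p * x + q)\<^sup>2) z t) (at 0)"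
      unfolding AtInfinity eventually_at_filter by (intro always_eventually) simp
    then show ?thesis using assms by blast
  qed
  then obtain p' q' k' where pq: "p' \<noteq> 0 \<or> q' \<noteq> 0" and
    ev: "eventually (\<lambda>t. k' / (p' + q' * t)\<^sup>2 = local_coeff (\<lambda>x. k / (p * x + q)\<^sup>2) z t) (at 0)"
    by blast
  have "(\<lambda>t. k' / (p' + q' * t)\<^sup>2) meromorphic_on {0}" by (intro meromorphic_intros)
  then show "local_coeff (\<lambda>x. k / (p * x + q)\<^sup>2) z meromorphic_on {0}"
    using meromorphic_on_cong[of "{0}" "\<lambda>t. k' / (p' + q' * t)\<^sup>2" _ "{0}"] ev by auto
  show "residue (local_coeff (\<lambda>x. k / (p * x + q)\<^sup>2) z) 0 = 0"
    using residue_cong[OF ev refl] residue_const_over_linear_square[OF pq] by simp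
qed

lemma eventually_at_notin_finite:
  assumes "finite (S :: complex set)"
  shows "eventually (\<lambda>x. x \<notin> S) (at a)"
  using assms islimpt_finite islimpt_iff_eventually by blast

lemma inj_chart: "inj (chart z)"
  by (cases z) (auto simp: inj_def split: if_splits)

lemma eventually_chart_notin_finite:
  assumes "finite E"
  shows "eventually (\<lambda>t. chart z t \<notin> E) (at 0)"
proof -
  have "finite (chart z -` E)"
    using assms inj_chart by (rule finite_vimageI)
  from eventually_at_notin_finite[OF this] show ?thesis by simp
qed

lemma infinite_affine_points: "infinite (range Affine)"
  using infinite_UNIV_char_0 finite_imageD[of Affine UNIV] by (auto simp: inj_on_def)

section \<open>The projective line in terms of a coordinate\<close>

context moebius
begin

lemma inverse_affine:
  assumes "c * x + d \<noteq> 0"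
  shows "a - c * u (Affine x) \<noteq> 0"
    and "x = (d * u (Affine x) - b) / (a - c * u (Affine x))"
    and "c * x + d = (a * d - b * c) / (a - c * u (Affine x))"
proof -
  have *: "a - c * u (Affine x) = (a * d - b * c) / (c * x + d)"
    using assms by (simp add: u_affine field_simps)
  then show ne: "a - c * u (Affine x) \<noteq> 0" using assms det by simp
  show "c * x + d = (a * d - b * c) / (a - c * u (Affine x))"
    unfolding * using assms det by simp
  have "d * u (Affine x) - b = x * ((a * d - b * c) / (c * x + d))"
    using assms by (simp add: u_affine field_simps)
  then show "x = (d * u (Affine x) - b) / (a - c * u (Affine x))"
    unfolding * using assms det by simp
qed

lemma inverse_infinity: "c \<noteq> 0 \<Longrightarrow> a - c * u AtInfinity = 0"
  by (simp add: u_infinity)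

lemma u_inj:
  assumes "\<not> pole_at u x" "\<not> pole_at u y" "u x = u y"
  shows "x = y"
  using assms
  by (cases x; cases y) (metis inverse_affine inverse_infinity pole_affine pole_infinity)+

lemma finite_poles: "finite {x. pole_at u x}"
proof (rule finite_subset)
  show "{x. pole_at u x} \<subseteq> {AtInfinity, Affine (- d / c)}"
  proof
    fix x assume "x \<in> {x. pole_at u x}"
    then show "x \<in> {AtInfinity, Affine (- d / c)}"
      using det by (cases x) (auto simp: pole_affine eq_divide_eq add_eq_0_iff mult.commute)
  qed
qed simp

lemma finite_u_vimage:
  assumes "finite V"
  shows "finite {x. \<not> pole_at u x \<and> u x \<in> V}"
proof (rule finite_imageD)
  show "finite (u ` {x. \<not> pole_at u x \<and> u x \<in> V})"
    by (rule finite_subset[OF _ assms]) auto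
  show "inj_on u {x. \<not> pole_at u x \<and> u x \<in> V}"
    by (auto simp: inj_on_def intro: u_inj)
qed

lemma deriv_u_affine:
  assumes "c * x + d \<noteq> 0"
  shows "deriv (\<lambda>y. u (Affine y)) x = (a * d - b * c) / (c * x + d)\<^sup>2"
    and "deriv (\<lambda>t. u (chart (Affine x) t)) 0 = (a * d - b * c) / (c * x + d)\<^sup>2"
proof -
  have "((\<lambda>y. (a * y + b) / (c * y + d)) has_field_derivative
     (a * (c * x + d) - (a * x + b) * c) / (c * x + d)\<^sup>2) (at x)"
    using assms by (auto intro!: derivative_eq_intros simp: power2_eq_square)
  then show "deriv (\<lambda>y. u (Affine y)) x = (a * d - b * c) / (c * x + d)\<^sup>2"
    unfolding u_affine by (intro DERIV_imp_deriv) (simp add: algebra_simps)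
  have "((\<lambda>t. (a * (x + t) + b) / (c * (x + t) + d)) has_field_derivative
     (a * (c * x + d) - (a * x + b) * c) / (c * x + d)\<^sup>2) (at 0)"
    using assms by (auto intro!: derivative_eq_intros simp: power2_eq_square)
  then show "deriv (\<lambda>t. u (chart (Affine x) t)) 0 = (a * d - b * c) / (c * x + d)\<^sup>2"
    unfolding chart.simps u_affine by (intro DERIV_imp_deriv) (simp add: algebra_simps)
qed

lemma u_chart_infinity: "u (chart AtInfinity t) = (a + b * t) / (c + d * t)"
proof (cases "t = 0")
  case True
  then show ?thesis by (simp add: u_infinity)
next
  case False
  have "a * (1 / t) + b = (a + b * t) / t" "c * (1 / t) + d = (c + d * t) / t"
    using False by (simp_all add: field_simps)
  then show ?thesis using False by (simp add: u_affine)
qed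

lemma deriv_u_infinity:
  assumes "c \<noteq> 0"
  shows "deriv (\<lambda>t. u (chart AtInfinity t)) 0 = - (a * d - b * c) / c\<^sup>2"
proof -
  have "((\<lambda>t. (a + b * t) / (c + d * t)) has_field_derivative (b * c - a * d) / c\<^sup>2) (at 0)"
    using assms by (auto intro!: derivative_eq_intros simp: power2_eq_square)
  then show ?thesis
    unfolding u_chart_infinity by (intro DERIV_imp_deriv) simp
qed

lemma u_chart_tendsto:
  assumes "\<not> pole_at u z"
  shows "((\<lambda>t. u (chart z t)) \<longlongrightarrow> u z) (at 0)"
proof (cases z)
  case (Affine x)
  have "((\<lambda>t. (a * (x + t) + b) / (c * (x + t) + d)) \<longlongrightarrow> (a * (x + 0) + b) / (c * (x + 0) + d)) (at 0)"
    using assms Affine by (intro tendsto_intros) (simp add: pole_affine)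
  then show ?thesis by (simp add: Affine u_affine)
next
  case AtInfinity
  have "((\<lambda>t. (a + b * t) / (c + d * t)) \<longlongrightarrow> (a + b * 0) / (c + d * 0)) (at 0)"
    using assms AtInfinity by (intro tendsto_intros) (simp add: pole_infinity)
  then show ?thesis unfolding AtInfinity u_chart_infinity by (simp add: u_infinity)
qed

lemma value_at_affine:
  assumes "c * x + d \<noteq> 0"
  shows "value_at u \<alpha> (Affine x) = dx_coeff \<alpha> x * (c * x + d)\<^sup>2 / (a * d - b * c)"
proof -
  have "remove_sings (local_coeff (dx_coeff \<alpha>) (Affine x)) 0 = dx_coeff \<alpha> x"
    using remove_sings_id[OF dx_coeff_nice(1)[of \<alpha>]] remove_sings_shift_0[of "dx_coeff \<alpha>" x]
    by (simp add: local_coeff.simps[abs_def])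
  then show ?thesis using assms unfolding value_at_def deriv_u_affine(2)[OF assms] by simp
qed

text \<open>
  The value at \<open>z\<close> is defined through the local parameter of \<open>z\<close>, the values nearby through other
  parameters. A change of parameter multiplies the coefficients of the form and of \<open>du\<close> by the same factor,
  so their quotient is continuous.
\<close>

lemma value_at_continuous:
  assumes "\<alpha> \<in> K_reg z" "\<not> pole_at u z"
  shows "((\<lambda>t. value_at u \<alpha> (chart z t)) \<longlongrightarrow> value_at u \<alpha> z) (at 0)"
proof -
  note L = K_reg_limit[OF assms(1)]
  have ev: "eventually (\<lambda>t. chart z t \<notin> {x. pole_at u x} \<and> t \<noteq> 0) (at 0)"
    by (intro eventually_conj eventually_chart_notin_finite finite_poles)
      (simp add: eventually_at_filter)
  show ?thesis
  proof (cases z)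
    case (Affine x)
    have cx: "c * x + d \<noteq> 0" using assms(2) Affine by (simp add: pole_affine)
    have "((\<lambda>t. local_coeff (dx_coeff \<alpha>) z t * (c * (x + t) + d)\<^sup>2 / (a * d - b * c)) \<longlongrightarrow>
       remove_sings (local_coeff (dx_coeff \<alpha>) z) 0 * (c * (x + 0) + d)\<^sup>2 / (a * d - b * c)) (at 0)"
      by (intro tendsto_intros L det)
    also have "remove_sings (local_coeff (dx_coeff \<alpha>) z) 0 * (c * (x + 0) + d)\<^sup>2 / (a * d - b * c) = value_at u \<alpha> z"
      unfolding value_at_def Affine deriv_u_affine(2)[OF cx] by simp
    finally show ?thesis
    proof (rule Lim_transform_eventually)
      show "eventually (\<lambda>t. local_coeff (dx_coeff \<alpha>) z t * (c * (x + t) + d)\<^sup>2 / (a * d - b * c)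
          = value_at u \<alpha> (chart z t)) (at 0)"
        using ev by eventually_elim (simp add: Affine pole_affine value_at_affine)
    qed
  next
    case AtInfinity
    have c: "c \<noteq> 0" using assms(2) AtInfinity by (simp add: pole_infinity)
    have "((\<lambda>t. local_coeff (dx_coeff \<alpha>) z t * - (c + d * t)\<^sup>2 / (a * d - b * c)) \<longlongrightarrow>
       remove_sings (local_coeff (dx_coeff \<alpha>) z) 0 * - (c + d * 0)\<^sup>2 / (a * d - b * c)) (at 0)"
      by (intro tendsto_intros L det)
    also have "remove_sings (local_coeff (dx_coeff \<alpha>) z) 0 * - (c + d * 0)\<^sup>2 / (a * d - b * c) = value_at u \<alpha> z"
      unfolding value_at_def AtInfinity deriv_u_infinity[OF c] by (simp add: minus_divide_right)
    finally show ?thesis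
    proof (rule Lim_transform_eventually)
      show "eventually (\<lambda>t. local_coeff (dx_coeff \<alpha>) z t * - (c + d * t)\<^sup>2 / (a * d - b * c)
          = value_at u \<alpha> (chart z t)) (at 0)"
        using ev
      proof eventually_elim
        case (elim t)
        then have "c * (1 / t) + d = (c + d * t) / t" "c * (1 / t) + d \<noteq> 0"
          by (auto simp: AtInfinity pole_affine field_simps)
        then show ?case using elim
          by (simp add: AtInfinity value_at_affine power_divide)
      qed
    qed
  qed
qed

section \<open>Forms are rational\<close>

text \<open>This transports rationality in \<open>x\<close> to rationality in \<open>U = u x\<close>, as \<open>x = (d U - b) / (a - c U)\<close>.\<close>

lemma homogenised_poly:
  "\<exists>Q n. \<forall>U. a - c * U \<noteq> 0 \<longrightarrow>
     poly Q U = (a - c * U) ^ n * poly p ((d * U - b) / (a - c * U))"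
proof (induction p)
  case 0
  show ?case by (intro exI[of _ 0]) simp
next
  case (pCons k p)
  then obtain Q n where Q: "\<And>U. a - c * U \<noteq> 0 \<Longrightarrow>
    poly Q U = (a - c * U) ^ n * poly p ((d * U - b) / (a - c * U))" by blast
  have "poly (smult k ([:a, - c:] ^ Suc n) + [:- b, d:] * Q) U
      = (a - c * U) ^ Suc n * poly (pCons k p) ((d * U - b) / (a - c * U))"
    if U: "a - c * U \<noteq> 0" for U
  proof -
    have *: "X ^ Suc n * (k + Y * R) = k * X ^ Suc n + (X * Y) * (X ^ n * R)" for X Y R
      by (simp add: algebra_simps)
    have "(a - c * U) * ((d * U - b) / (a - c * U)) = d * U - b" using U by simp
    then have "(a - c * U) ^ Suc n * poly (pCons k p) ((d * U - b) / (a - c * U))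
       = k * (a - c * U) ^ Suc n + (d * U - b) * poly Q U"
      by (simp only: Q[OF U] poly_pCons *)
    moreover have "poly [:a, - c:] U = a - c * U" "poly [:- b, d:] U = d * U - b"
      by simp_all
    ultimately show ?thesis by (simp only: poly_add poly_smult poly_mult poly_power)
  qed
  then show ?case by blast
qed

lemma infinite_affine_nonpole: "infinite {x. c * x + d \<noteq> 0}"
proof -
  have "finite {x. Affine x \<in> {x. pole_at u x}}"
    using finite_vimageI[OF finite_poles, of Affine] by (auto simp: vimage_def inj_def)
  moreover have "infinite (UNIV :: complex set)" by (rule infinite_UNIV_char_0)
  moreover have "UNIV = {x. c * x + d \<noteq> 0} \<union> {x. Affine x \<in> {x. pole_at u x}}"
    by (auto simp: pole_affine)
  ultimately show ?thesis by (metis finite_UnI)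
qed

text \<open>
  On the affine line the form is \<open>f dx\<close> with \<open>f\<close> rational, and both \<open>x\<close> and \<open>du / dx\<close> are rational functions
  of \<open>u\<close>. A finite exceptional set is allowed here, so that the point at infinity need not be
  treated.
\<close>

lemma form_generically_rational:
  "\<exists>p q. q \<noteq> 0 \<and>
     finite {x. \<not> (\<alpha> \<in> K_reg x \<and> value_at u \<alpha> x = poly p (u x) / poly q (u x))}"
proof -
  define f where "f = dx_coeff \<alpha>"
  have sk: "second_kind f" using dx_coeff[of \<alpha>] by (simp add: f_def)
  have "local_coeff f AtInfinity meromorphic_on {0}"
    using sk unfolding second_kind_def by blast
  then have "(\<lambda>t. - (t\<^sup>2 * local_coeff f AtInfinity t)) meromorphic_on {0}"
    by (intro meromorphic_intros)
  then have "(\<lambda>t. f (1 / t)) meromorphic_on {0}"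
    by (subst meromorphic_on_cong[of "{0}" _ "\<lambda>t. - (t\<^sup>2 * local_coeff f AtInfinity t)" "{0}"])
      (auto simp: eventually_at_filter)
  then obtain P Q where Q: "Q \<noteq> 0" and fin: "finite {x. f x \<noteq> poly P x / poly Q x}"
    using meromorphic_imp_rational[of f] sk unfolding second_kind_def by metis
  obtain P' n where P': "\<And>U. a - c * U \<noteq> 0 \<Longrightarrow>
      poly P' U = (a - c * U) ^ n * poly P ((d * U - b) / (a - c * U))"
    using homogenised_poly[of P] by blast
  obtain Q' m where Q': "\<And>U. a - c * U \<noteq> 0 \<Longrightarrow>
      poly Q' U = (a - c * U) ^ m * poly Q ((d * U - b) / (a - c * U))"
    using homogenised_poly[of Q] by blast
  define E where "E = {x. f x \<noteq> poly P x / poly Q x} \<union> {x. poly Q x = 0}"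
  have E: "finite E" using fin Q by (simp add: E_def poly_roots_finite)
  define p where "p = smult (a * d - b * c) ([:a, - c:] ^ m) * P'"
  define q where "q = [:a, - c:] ^ (n + 2) * Q'"
  have val: "\<alpha> \<in> K_reg (Affine x) \<and> value_at u \<alpha> (Affine x) = poly p (u (Affine x)) / poly q (u (Affine x))
      \<and> poly Q' (u (Affine x)) \<noteq> 0"
    if x: "x \<notin> E" "c * x + d \<noteq> 0" for x
  proof -
    have fx: "f x = poly P x / poly Q x" and Qx: "poly Q x \<noteq> 0" using x by (auto simp: E_def)
    define U where "U = u (Affine x)"
    note inv = inverse_affine[OF x(2), folded U_def]
    have "poly P' U = (a - c * U) ^ n * poly P x" "poly Q' U = (a - c * U) ^ m * poly Q x"
      using P'[OF inv(1)] Q'[OF inv(1)] inv(2) by simp_all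
    then have PQ: "poly p U = (a * d - b * c) * (a - c * U) ^ m * (a - c * U) ^ n * poly P x"
      "poly q U = (a - c * U) ^ (n + 2) * (a - c * U) ^ m * poly Q x"
      unfolding p_def q_def poly_smult poly_mult poly_power by (simp_all add: mult_ac)
    have "value_at u \<alpha> (Affine x) = f x * ((a * d - b * c) / (a - c * U))\<^sup>2 / (a * d - b * c)"
      using value_at_affine[OF x(2)] inv(3) by (simp add: f_def)
    also have "\<dots> = poly P x / poly Q x * (a * d - b * c) / (a - c * U)\<^sup>2"
      using det by (simp add: fx power2_eq_square)
    also have "\<dots> = poly p U / poly q U"
    proof -
      have "P / Q * K / X\<^sup>2 = K * X ^ m * X ^ n * P / (X ^ (n + 2) * X ^ m * Q)"
        if "X \<noteq> 0" "Q \<noteq> 0" for P Q K X :: complex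
        using that by (simp add: power_add power2_eq_square divide_simps)
      from this[OF inv(1) Qx] show ?thesis unfolding PQ .
    qed
    finally have v: "value_at u \<alpha> (Affine x) = poly p U / poly q U" .
    have "((\<lambda>y. poly P y / poly Q y) \<longlongrightarrow> poly P x / poly Q x) (at x)"
      using Qx by (intro tendsto_intros) auto
    moreover have "eventually (\<lambda>y. poly P y / poly Q y = f y) (at x)"
      using eventually_at_notin_finite[OF E] by eventually_elim (simp add: E_def)
    ultimately have "(f \<longlongrightarrow> poly P x / poly Q x) (at x)"
      by (rule Lim_transform_eventually)
    then have "((\<lambda>t. f (x + t)) \<longlongrightarrow> poly P x / poly Q x) (at 0)"
      by (simp add: at_to_0[of x] filterlim_filtermap add.commute)
    then have "\<alpha> \<in> K_reg (Affine x)"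
      by (auto simp: K_reg_iff_limit f_def local_coeff.simps[abs_def])
    moreover have "poly Q' U \<noteq> 0" using Q'[OF inv(1)] inv(1,2) Qx by simp
    ultimately show ?thesis using v by (simp add: U_def)
  qed
  obtain x where "x \<notin> E" "c * x + d \<noteq> 0"
    using infinite_affine_nonpole E
    by (metis (mono_tags, lifting) mem_Collect_eq rev_finite_subset subsetI)
  then have "Q' \<noteq> 0" using val by force
  moreover have "[:a, - c:] \<noteq> 0" using det by auto
  ultimately have "q \<noteq> 0" unfolding q_def by (intro no_zero_divisors power_not_zero)
  moreover have "{x. \<not> (\<alpha> \<in> K_reg x \<and> value_at u \<alpha> x = poly p (u x) / poly q (u x))}
      \<subseteq> insert AtInfinity (Affine ` E \<union> {x. pole_at u x})" (is "?A \<subseteq> ?B")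
  proof
    fix x assume x: "x \<in> ?A"
    show "x \<in> ?B"
      using val x by (cases x) (auto simp: pole_affine)
  qed
  then have "finite ?A" by (rule finite_subset) (simp add: E finite_poles)
  ultimately show ?thesis by blast
qed

lemma finite_singular_points: "finite {x. \<alpha> \<notin> K_reg x}"
proof -
  obtain p q where "finite {x. \<not> (\<alpha> \<in> K_reg x \<and> value_at u \<alpha> x = poly p (u x) / poly q (u x))}"
    using form_generically_rational[of \<alpha>] by blast
  then show ?thesis by (rule rev_finite_subset) auto
qed

text \<open>
  In a representation \<open>p / q\<close> with \<open>q\<close> of minimal degree, \<open>q\<close> cannot vanish at \<open>z\<close>: by continuity
  \<open>p = q\<close> times the value of the form there, so that \<open>p\<close> would vanish too and a common factor could be
  cancelled. The same identity gives the value at \<open>z\<close> itself. The exceptional points other than \<open>z\<close>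
  are then made zeros of the denominator.
\<close>

lemma form_rational_near:
  assumes "\<alpha> \<in> K_reg z" "\<not> pole_at u z"
  shows "\<exists>p q. poly q (u z) \<noteq> 0 \<and> (\<forall>x. \<not> pole_at u x \<and> poly q (u x) \<noteq> 0 \<longrightarrow>
       \<alpha> \<in> K_reg x \<and> value_at u \<alpha> x = poly p (u x) / poly q (u x))"
proof -
  define bad where "bad p q = {x. \<not> (\<alpha> \<in> K_reg x \<and> value_at u \<alpha> x = poly p (u x) / poly q (u x))}" for p q
  have "\<exists>n p q. q \<noteq> 0 \<and> finite (bad p q) \<and> degree q = n"
    using form_generically_rational[of \<alpha>] unfolding bad_def by blast
  then obtain n where "\<exists>p q. q \<noteq> 0 \<and> finite (bad p q) \<and> degree q = n"
    and minimal: "\<And>k. k < n \<Longrightarrow> \<not> (\<exists>p q. q \<noteq> 0 \<and> finite (bad p q) \<and> degree q = k)"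
    using exists_least_iff[of "\<lambda>n. \<exists>p q. q \<noteq> 0 \<and> finite (bad p q) \<and> degree q = n"] by blast
  then obtain p q where q0: "q \<noteq> 0" and fin: "finite (bad p q)" and deg: "degree q = n"
    by blast
  define E where "E = bad p q \<union> {x. \<not> pole_at u x \<and> u x \<in> {y. poly q y = 0}} \<union> {x. pole_at u x}"
  have E: "finite E"
    unfolding E_def by (intro finite_UnI fin finite_u_vimage finite_poles poly_roots_finite q0)
  have good: "\<not> pole_at u x \<and> \<alpha> \<in> K_reg x \<and> poly q (u x) \<noteq> 0 \<and> value_at u \<alpha> x = poly p (u x) / poly q (u x)"
    if "x \<notin> E" for x
    using that by (auto simp: E_def bad_def)
  have "((\<lambda>t. value_at u \<alpha> (chart z t) * poly q (u (chart z t))) \<longlongrightarrow> value_at u \<alpha> z * poly q (u z)) (at 0)"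
    by (intro tendsto_intros value_at_continuous u_chart_tendsto assms)
  moreover have "eventually (\<lambda>t. value_at u \<alpha> (chart z t) * poly q (u (chart z t)) = poly p (u (chart z t))) (at 0)"
    using eventually_chart_notin_finite[OF E, of z] by eventually_elim (use good in auto)
  ultimately have "((\<lambda>t. poly p (u (chart z t))) \<longlongrightarrow> value_at u \<alpha> z * poly q (u z)) (at 0)"
    by (rule Lim_transform_eventually)
  moreover have "((\<lambda>t. poly p (u (chart z t))) \<longlongrightarrow> poly p (u z)) (at 0)"
    by (intro tendsto_intros u_chart_tendsto assms)
  ultimately have eq: "value_at u \<alpha> z * poly q (u z) = poly p (u z)"
    by (rule tendsto_unique[OF at_neq_bot])
  have qz: "poly q (u z) \<noteq> 0"
  proof
    assume "poly q (u z) = 0"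
    moreover from this eq have "poly p (u z) = 0" by simp
    ultimately obtain p1 q1 where pq1: "p = [:- u z, 1:] * p1" "q = [:- u z, 1:] * q1"
      by (auto simp: poly_eq_0_iff_dvd dvd_def)
    then have "q1 \<noteq> 0" using q0 by auto
    have pp: "poly p y = (y - u z) * poly p1 y" "poly q y = (y - u z) * poly q1 y" for y
      by (simp_all add: pq1 algebra_simps)
    have "degree q = degree [:- u z, 1:] + degree q1"
      unfolding pq1(2) by (rule degree_mult_eq) (use \<open>q1 \<noteq> 0\<close> in auto)
    then have "degree q1 < n" using deg by simp
    moreover have "bad p1 q1 \<subseteq> E"
    proof (rule ccontr)
      assume "\<not> bad p1 q1 \<subseteq> E"
      then obtain x where x: "x \<in> bad p1 q1" "x \<notin> E" by blast
      from good[OF x(2)] have "\<alpha> \<in> K_reg x" "u x - u z \<noteq> 0" "value_at u \<alpha> x = poly p1 (u x) / poly q1 (u x)"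
        unfolding pp by auto
      then show False using x(1) by (simp add: bad_def)
    qed
    then have "finite (bad p1 q1)" by (rule finite_subset) (rule E)
    ultimately show False using minimal[of "degree q1"] \<open>q1 \<noteq> 0\<close> by blast
  qed
  \<comment> \<open>\<open>r\<close> vanishes at the exceptional points other than \<open>z\<close>, and so excludes them.\<close>
  define r where "r = (\<Prod>x\<in>E - {z}. if pole_at u x then 1 else [:- u x, 1:])"
  have r: "poly r y = (\<Prod>x\<in>E - {z}. if pole_at u x then 1 else y - u x)" for y
    unfolding r_def poly_prod by (intro prod.cong) auto
  have rz: "poly r (u z) \<noteq> 0"
    using E u_inj[OF assms(2)] by (auto simp: r)
  have "\<alpha> \<in> K_reg x \<and> value_at u \<alpha> x = poly (p * r) (u x) / poly (q * r) (u x)"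
    if x: "\<not> pole_at u x" "poly (q * r) (u x) \<noteq> 0" for x
  proof (cases "x = z")
    case True
    then show ?thesis using eq assms(1) qz rz by (simp add: field_simps)
  next
    case False
    have "x \<notin> E"
    proof
      assume "x \<in> E"
      then have "poly r (u x) = 0" using E False x(1) by (auto simp: r intro!: prod_zero bexI[of _ x])
      then show False using x(2) by simp
    qed
    then show ?thesis using good[of x] x(2) by simp
  qed
  moreover have "poly (q * r) (u z) \<noteq> 0" using qz rz by simp
  ultimately show ?thesis by blast
qed

lemma forms_common_denominator:
  assumes "\<not> pole_at u z"
  shows "finite A \<Longrightarrow> A \<subseteq> K_reg z \<Longrightarrow>
     \<exists>q. poly q (u z) \<noteq> 0 \<and> (\<forall>\<alpha>\<in>A. \<exists>p. \<forall>x. \<not> pole_at u x \<and> poly q (u x) \<noteq> 0 \<longrightarrow>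
       \<alpha> \<in> K_reg x \<and> value_at u \<alpha> x = poly p (u x) / poly q (u x))"
proof (induction A rule: finite_induct)
  case empty
  show ?case by (intro exI[of _ 1]) simp
next
  case (insert \<beta> A)
  then obtain q where q: "poly q (u z) \<noteq> 0" "\<forall>\<alpha>\<in>A. \<exists>p. \<forall>x. \<not> pole_at u x \<and> poly q (u x) \<noteq> 0 \<longrightarrow>
     \<alpha> \<in> K_reg x \<and> value_at u \<alpha> x = poly p (u x) / poly q (u x)" by auto
  obtain p' q' where q': "poly q' (u z) \<noteq> 0"
    "\<forall>x. \<not> pole_at u x \<and> poly q' (u x) \<noteq> 0 \<longrightarrow>
       \<beta> \<in> K_reg x \<and> value_at u \<beta> x = poly p' (u x) / poly q' (u x)"
    using form_rational_near[OF _ assms, of \<beta>] insert.prems by auto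
  show ?case
  proof (rule exI[of _ "q * q'"], intro conjI ballI)
    show "poly (q * q') (u z) \<noteq> 0" using q q' by simp
    fix \<alpha> assume \<alpha>: "\<alpha> \<in> insert \<beta> A"
    show "\<exists>p. \<forall>x. \<not> pole_at u x \<and> poly (q * q') (u x) \<noteq> 0 \<longrightarrow>
       \<alpha> \<in> K_reg x \<and> value_at u \<alpha> x = poly p (u x) / poly (q * q') (u x)"
    proof (cases "\<alpha> = \<beta>")
      case True
      then show ?thesis using q' by (intro exI[of _ "q * p'"]) auto
    next
      case False
      then obtain p where "\<forall>x. \<not> pole_at u x \<and> poly q (u x) \<noteq> 0 \<longrightarrow>
        \<alpha> \<in> K_reg x \<and> value_at u \<alpha> x = poly p (u x) / poly q (u x)" using q(2) \<alpha> by auto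
      then show ?thesis by (intro exI[of _ "p * q'"]) auto
    qed
  qed
qed

text \<open>
  Writing \<open>u - u z = (p x + q) / (c x + d)\<close>, the factors \<open>(c x + d)\<^sup>2\<close> coming from \<open>du\<close> and from the denominator
  cancel, and \<open>e(z)\<close> becomes a constant multiple of \<open>dx / (p x + q)\<^sup>2\<close>. Away from \<open>z\<close> it is regular, also at the
  point at infinity.
\<close>

lemma
  assumes "\<not> pole_at u z" "\<not> pole_at u x" "x \<noteq> z"
  shows e_form_regular: "e_form u z \<in> K_reg x"
    and value_at_e_form: "value_at u (e_form u z) x = - 1 / (u x - u z)\<^sup>2"
proof -
  define p q where "p = a - u z * c" and "q = b - u z * d"
  have pq: "p \<noteq> 0 \<or> q \<noteq> 0"
  proof (rule ccontr)
    assume "\<not> (p \<noteq> 0 \<or> q \<noteq> 0)"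
    then have "a = u z * c" "b = u z * d" by (simp_all add: p_def q_def)
    then show False using det by (simp add: mult_ac)
  qed
  define g where "g = (\<lambda>x. - deriv (\<lambda>y. u (Affine y)) x / (u (Affine x) - u z)\<^sup>2)"
  define h where "h = (\<lambda>x. - (a * d - b * c) / (p * x + q)\<^sup>2)"
  have diff: "u (Affine x) - u z = (p * x + q) / (c * x + d)" if "c * x + d \<noteq> 0" for x
    using that by (simp add: u_affine p_def q_def field_simps)
  have gh: "g x = h x" if "c * x + d \<noteq> 0" for x
    unfolding g_def h_def diff[OF that] deriv_u_affine(1)[OF that] using that by (simp add: power_divide)
  have poles: "finite {x. c * x + d = 0}"
    using finite_vimageI[OF finite_poles, of Affine] by (auto simp: vimage_def inj_def pole_affine)
  have ev: "eventually (\<lambda>x. g x = h x) (at x)" for x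
    using eventually_at_notin_finite[OF poles] by eventually_elim (simp add: gh)
  have "remove_sings g = remove_sings h"
    by (intro ext remove_sings_cong ev refl)
  then have "e_form u z = Abs_form (remove_sings h)"
    by (simp add: e_form_def mk_form_def g_def)
  moreover have "second_kind h" unfolding h_def by (rule second_kind_const_over_linear_square[OF pq])
  moreover from this have "remove_sings h nicely_meromorphic_on UNIV"
    by (intro remove_sings_nicely_meromorphic) (simp add: second_kind_def)
  ultimately have coeff: "dx_coeff (e_form u z) = remove_sings h"
    by (simp add: Abs_form_inverse second_kind_remove_sings)
  have coeff_h: "dx_coeff (e_form u z) y = h y" if "p * y + q \<noteq> 0" for y
  proof -
    have "h analytic_on {y}" unfolding h_def using that by (auto intro!: analytic_intros)
    then show ?thesis by (simp add: coeff)
  qed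
  have "e_form u z \<in> K_reg x \<and> value_at u (e_form u z) x = - 1 / (u x - u z)\<^sup>2"
  proof (cases x)
    case (Affine y)
    have cy: "c * y + d \<noteq> 0" using assms(2) Affine by (simp add: pole_affine)
    have "u (Affine y) \<noteq> u z" using u_inj[of "Affine y" z] assms Affine by auto
    then have py: "p * y + q \<noteq> 0" using diff[OF cy] by auto
    have "((\<lambda>t. p * (y + t) + q) \<longlongrightarrow> p * (y + 0) + q) (at 0)" by (intro tendsto_intros)
    then have "eventually (\<lambda>t. p * (y + t) + q \<noteq> 0) (at 0)"
      using py by (intro tendsto_imp_eventually_ne) auto
    then have "eventually (\<lambda>t. h (y + t) = local_coeff (dx_coeff (e_form u z)) x t) (at 0)"
      by eventually_elim (simp add: Affine coeff_h)
    moreover have "((\<lambda>t. h (y + t)) \<longlongrightarrow> - (a * d - b * c) / (p * (y + 0) + q)\<^sup>2) (at 0)"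
      unfolding h_def using py by (intro tendsto_intros) auto
    ultimately have "(local_coeff (dx_coeff (e_form u z)) x \<longlongrightarrow>
        - (a * d - b * c) / (p * (y + 0) + q)\<^sup>2) (at 0)"
      by (rule Lim_transform_eventually[rotated])
    then have "e_form u z \<in> K_reg x"
      unfolding K_reg_iff_limit by blast
    moreover have "value_at u (e_form u z) x = - 1 / (u x - u z)\<^sup>2"
    proof -
      have "- k / (p * y + q)\<^sup>2 * (c * y + d)\<^sup>2 / k = - 1 / ((p * y + q) / (c * y + d))\<^sup>2"
        if "k \<noteq> 0" for k
        using that by (simp add: power_divide)
      from this[OF det] show ?thesis
        unfolding Affine value_at_affine[OF cy] coeff_h[OF py] diff[OF cy] h_def .
    qed
    ultimately show ?thesis by simp
  next
    case AtInfinity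
    have c: "c \<noteq> 0" using assms(2) AtInfinity by (simp add: pole_infinity)
    have "a / c \<noteq> u z" using u_inj[of AtInfinity z] assms AtInfinity by (auto simp: u_infinity)
    then have p: "p \<noteq> 0" using c by (auto simp: p_def)
    have "((\<lambda>t. p + q * t) \<longlongrightarrow> p + q * 0) (at 0)" by (intro tendsto_intros)
    then have "eventually (\<lambda>t. p + q * t \<noteq> 0) (at 0)"
      using p by (intro tendsto_imp_eventually_ne) auto
    moreover have "eventually (\<lambda>t. t \<noteq> 0) (at (0::complex))" by (simp add: eventually_at_filter)
    ultimately have "eventually (\<lambda>t. (a * d - b * c) / (p + q * t)\<^sup>2 = local_coeff (dx_coeff (e_form u z)) x t) (at 0)"
    proof eventually_elim
      case (elim t)
      then have *: "p * (1 / t) + q = (p + q * t) / t" by (simp add: field_simps)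
      then have "p * (1 / t) + q \<noteq> 0" using elim by simp
      from coeff_h[OF this]
      have "local_coeff (dx_coeff (e_form u z)) x t = - (- (a * d - b * c) / ((p + q * t) / t)\<^sup>2) / t\<^sup>2"
        unfolding AtInfinity local_coeff.simps h_def * by simp
      moreover have "- (- k / ((p + q * t) / t)\<^sup>2) / t\<^sup>2 = k / (p + q * t)\<^sup>2" for k
        using elim by (simp add: power_divide)
      ultimately show ?case by metis
    qed
    moreover have "((\<lambda>t. (a * d - b * c) / (p + q * t)\<^sup>2) \<longlongrightarrow> (a * d - b * c) / (p + q * 0)\<^sup>2) (at 0)"
      using p by (intro tendsto_intros) auto
    ultimately have lim: "(local_coeff (dx_coeff (e_form u z)) x \<longlongrightarrow> (a * d - b * c) / (p + q * 0)\<^sup>2) (at 0)"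
      by (rule Lim_transform_eventually[rotated])
    then have "value_at u (e_form u z) x = (a * d - b * c) / p\<^sup>2 / (- (a * d - b * c) / c\<^sup>2)"
      using remove_sings_eqI[OF lim] unfolding value_at_def AtInfinity deriv_u_infinity[OF c] by simp
    also have "\<dots> = - 1 / (u x - u z)\<^sup>2"
    proof -
      have *: "u x - u z = p / c" using c by (simp add: AtInfinity u_infinity p_def diff_divide_distrib)
      have "k / p\<^sup>2 / (- k / c\<^sup>2) = - 1 / (p / c)\<^sup>2" if "k \<noteq> 0" for k
        using that c p by (simp add: power_divide)
      from this[OF det] show ?thesis unfolding * .
    qed
    finally show ?thesis using lim by (auto simp: K_reg_iff_limit)
  qed
  then show "e_form u z \<in> K_reg x" "value_at u (e_form u z) x = - 1 / (u x - u z)\<^sup>2" by auto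
qed

end

section \<open>Components of monomials\<close>

lemma polynomial_fun_sum:
  "(\<And>i. i \<in> I \<Longrightarrow> polynomial_fun n (f i)) \<Longrightarrow> polynomial_fun n (\<lambda>l. \<Sum>i\<in>I. f i l)"
  by (induction I rule: infinite_finite_induct) (auto intro: polynomial_fun.intros)

lemma polynomial_fun_prod:
  "(\<And>i. i \<in> I \<Longrightarrow> polynomial_fun n (f i)) \<Longrightarrow> polynomial_fun n (\<lambda>l. \<Prod>i\<in>I. f i l)"
  by (induction I rule: infinite_finite_induct) (auto intro: polynomial_fun.intros)

lemma polynomial_fun_poly: "i < n \<Longrightarrow> polynomial_fun n (\<lambda>l. poly p (l ! i))"
proof (induction p)
  case (pCons a p)
  then show ?case unfolding poly_pCons by (intro polynomial_fun.intros)
qed (simp add: polynomial_fun.const)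

text \<open>
  Polynomials in two variables, stated through the possibility of substituting any two of \<open>n\<close> variables,
  which is the only way in which they are used.
\<close>

definition bipolynomial :: "(complex \<Rightarrow> complex \<Rightarrow> complex) \<Rightarrow> bool" where
  "bipolynomial R \<longleftrightarrow> (\<forall>n i j. i < n \<longrightarrow> j < n \<longrightarrow> polynomial_fun n (\<lambda>l. R (l ! i) (l ! j)))"

lemma bipolynomial_first: "bipolynomial (\<lambda>x z. poly p x)"
  by (simp add: bipolynomial_def polynomial_fun_poly)

lemma bipolynomial_mult: "bipolynomial R \<Longrightarrow> bipolynomial S \<Longrightarrow> bipolynomial (\<lambda>x z. R x z * S x z)"
  by (simp add: bipolynomial_def polynomial_fun.mult)

lemma bipolynomial_const: "bipolynomial (\<lambda>x z. k)"
  by (simp add: bipolynomial_def polynomial_fun.const)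

lemma bipolynomial_diff_squared: "bipolynomial (\<lambda>x z. (x - z)\<^sup>2)"
proof -
  have "polynomial_fun n (\<lambda>l. (l ! i + (- 1) * l ! j) * (l ! i + (- 1) * l ! j))" if "i < n" "j < n" for n i j
    using that by (intro polynomial_fun.intros)
  then show ?thesis by (simp add: bipolynomial_def power2_eq_square)
qed

lemma bipolynomial_diff_const_squared: "bipolynomial (\<lambda>x z. (x - k)\<^sup>2)"
  using bipolynomial_first[of "[:- k, 1:]\<^sup>2"] by simp

lemma Inter_K_reg_linear:
  assumes "x \<in> X"
  shows "complex_linear_on (\<Inter>x\<in>X. K_reg x) (\<lambda>\<alpha>. value_at u \<alpha> x)"
  using value_at_linear[of _ u] assms unfolding complex_linear_on_def by simp

lemma polydiff_add:
  assumes "polydiff_regular xs v" "polydiff_regular xs w"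
  shows "polydiff_regular xs (v + w)" "polydiff u xs (v + w) = polydiff u xs v + polydiff u xs w"
proof -
  show "polydiff_regular xs (v + w)" using assms by (simp add: polydiff_regular_def Sym.add)
  show "polydiff u xs (v + w) = polydiff u xs v + polydiff u xs w"
    using assms unfolding polydiff_def polydiff_regular_def
    by (intro sym_eval_add) (auto intro: Inter_K_reg_linear)
qed

lemma polydiff_monomial:
  assumes "\<And>a x. a \<in> set as \<Longrightarrow> x \<in> set xs \<Longrightarrow> a \<in> K_reg x"
  shows "polydiff_regular xs (k *\<^sub>C prod_list (map sym_gen as))"
    and "polydiff u xs (k *\<^sub>C prod_list (map sym_gen as)) =
      (if length as = length xs
       then k * (\<Sum>\<sigma> | \<sigma> permutes {..<length xs}. \<Prod>i<length xs. value_at u (as ! \<sigma> i) (xs ! i))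
       else 0)"
proof -
  let ?A = "\<Inter>x\<in>set xs. K_reg x"
  let ?\<phi>s = "map (\<lambda>x \<alpha>. value_at u \<alpha> x) xs"
  have as: "set as \<subseteq> ?A" using assms by auto
  have lin: "complex_linear_on ?A \<phi>" if "\<phi> \<in> set ?\<phi>s" for \<phi>
    using that by (auto intro: Inter_K_reg_linear)
  show "polydiff_regular xs (k *\<^sub>C prod_list (map sym_gen as))"
    unfolding polydiff_regular_def by (intro Sym.scale Sym_prod_list as)
  show "polydiff u xs (k *\<^sub>C prod_list (map sym_gen as)) =
      (if length as = length xs
       then k * (\<Sum>\<sigma> | \<sigma> permutes {..<length xs}. \<Prod>i<length xs. value_at u (as ! \<sigma> i) (xs ! i))
       else 0)"
  proof -
    have "sym_eval ?A ?\<phi>s (k *\<^sub>C prod_list (map sym_gen as)) = k * sym_eval ?A ?\<phi>s (prod_list (map sym_gen as))"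
      by (intro sym_eval_scaleC lin Sym_prod_list as)
    moreover have "sym_eval ?A ?\<phi>s (prod_list (map sym_gen as)) =
        (if length as = length ?\<phi>s
         then \<Sum>\<sigma> | \<sigma> permutes {..<length ?\<phi>s}. \<Prod>i<length ?\<phi>s. (?\<phi>s ! i) (as ! \<sigma> i) else 0)"
      by (intro sym_eval_prod_list lin as)
    ultimately show ?thesis by (simp add: polydiff_def)
  qed
qed

section \<open>Families of vectors depending rationally on a point\<close>

text \<open>
  The predicate \<open>good\<close> describes a Zariski neighbourhood of the base point. All forms occurring
  in the families have values with the common denominator \<open>denom (u x) (u z)\<close>, where \<open>x\<close> is the auxiliary point
  and \<open>z\<close> the parameter; it must not vanish identically in \<open>x\<close> for any good \<open>z\<close>.
\<close>

locale rational_families = moebius +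
  fixes good :: "pline \<Rightarrow> bool" and denom :: "complex \<Rightarrow> complex \<Rightarrow> complex"
  assumes good_nonpole: "good z \<Longrightarrow> \<not> pole_at u z"
    and denom_bipolynomial: "bipolynomial denom"
    and denom_generic: "good z \<Longrightarrow> \<exists>x. \<not> pole_at u x \<and> denom (u x) (u z) \<noteq> 0"
begin

definition form_family :: "(pline \<Rightarrow> form) \<Rightarrow> bool" where
  "form_family \<alpha> \<longleftrightarrow> (\<exists>R. bipolynomial R \<and>
     (\<forall>z x. good z \<and> \<not> pole_at u x \<and> denom (u x) (u z) \<noteq> 0 \<longrightarrow>
        \<alpha> z \<in> K_reg x \<and> value_at u (\<alpha> z) x = R (u x) (u z) / denom (u x) (u z)))"

text \<open>
  The families are required to be sums of monomials over the good points only, because the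
  field \<open>i(z)\<close> has its meaning on a given vector only there.
\<close>

inductive rational_family :: "(pline \<Rightarrow> form sym_alg) \<Rightarrow> bool" where
  monomial: "(\<And>\<alpha>. \<alpha> \<in> set \<alpha>s \<Longrightarrow> form_family \<alpha>) \<Longrightarrow> (\<And>z. good z \<Longrightarrow> poly r (u z) \<noteq> 0) \<Longrightarrow>
    (\<And>z. good z \<Longrightarrow> F z = (poly p (u z) / poly r (u z)) *\<^sub>C prod_list (map (\<lambda>\<alpha>. sym_gen (\<alpha> z)) \<alpha>s)) \<Longrightarrow>
    rational_family F"
| add: "rational_family F \<Longrightarrow> rational_family G \<Longrightarrow> (\<And>z. good z \<Longrightarrow> H z = F z + G z) \<Longrightarrow> rational_family H"

lemma rational_family_scalar:
  assumes "\<And>z. good z \<Longrightarrow> poly r (u z) \<noteq> 0" "\<And>z. good z \<Longrightarrow> F z = (poly p (u z) / poly r (u z)) *\<^sub>C 1"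
  shows "rational_family F"
  by (rule monomial[of "[]" r F p]) (simp_all add: assms)

lemma rational_family_gen:
  assumes "form_family \<alpha>"
  shows "rational_family (\<lambda>z. sym_gen (\<alpha> z))"
  by (rule monomial[of "[\<alpha>]" 1 _ 1]) (simp_all add: assms scaleC_one)

lemma rational_family_plus: "rational_family F \<Longrightarrow> rational_family G \<Longrightarrow> rational_family (\<lambda>z. F z + G z)"
  by (rule add) auto

lemma rational_family_mult:
  assumes "rational_family F" "rational_family G"
  shows "rational_family (\<lambda>z. F z * G z)"
  using assms(1)
proof induction
  case (monomial \<alpha>s r F p)
  note F = this
  show ?case
    using assms(2)
  proof induction
    case (monomial \<beta>s s G q)
    show ?case
    proof (rule rational_family.monomial[of "\<alpha>s @ \<beta>s" "r * s" _ "p * q"])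
      fix z assume "good z"
      then show "F z * G z = (poly (p * q) (u z) / poly (r * s) (u z)) *\<^sub>C
          prod_list (map (\<lambda>\<alpha>. sym_gen (\<alpha> z)) (\<alpha>s @ \<beta>s))"
        using F(3)[of z] monomial(3)[of z]
        by (simp add: scaleC_mult_left scaleC_mult_right scaleC_scaleC mult.commute)
    qed (use F monomial in auto)
  next
    case (add G1 G2 G)
    show ?case by (rule rational_family.add[OF add.IH]) (simp add: add.hyps distrib_left)
  qed
next
  case (add F1 F2 F)
  show ?case by (rule rational_family.add[OF add.IH]) (simp add: add.hyps distrib_right)
qed

lemma rational_family_scaleC:
  assumes "rational_family F"
  shows "rational_family (\<lambda>z. k *\<^sub>C F z)"
proof -
  have "rational_family (\<lambda>z. k *\<^sub>C 1)"
    by (rule rational_family_scalar[of 1 _ "[:k:]"]) simp_all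
  from rational_family_mult[OF this assms] show ?thesis by (simp add: scaleC_mult_left)
qed

text \<open>
  The component of a monomial is a permanent, each of whose products takes one factor from every row
  \<open>i\<close> and so has the denominator \<open>\<Prod>i<m. denom (u (xs ! i)) (u z)\<close>. Since this does not depend on
  the monomial, sums only require a common denominator of the coefficients, which are functions of \<open>z\<close> alone.
\<close>

lemma rational_family_component:
  assumes "rational_family F"
  shows "\<exists>P r. polynomial_fun (Suc m) P \<and> (\<forall>z. good z \<longrightarrow> poly r (u z) \<noteq> 0) \<and>
    (\<forall>z xs. good z \<and> length xs = m \<and> (\<forall>x\<in>set xs. \<not> pole_at u x \<and> denom (u x) (u z) \<noteq> 0) \<longrightarrow>
       polydiff_regular xs (F z) \<and>
       polydiff u xs (F z) = P (map u xs @ [u z]) / (poly r (u z) * (\<Prod>i<m. denom (u (xs ! i)) (u z))))"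
  using assms
proof induction
  case (monomial \<alpha>s r F p)
  have "\<exists>R. bipolynomial R \<and>
     (\<forall>z x. good z \<and> \<not> pole_at u x \<and> denom (u x) (u z) \<noteq> 0 \<longrightarrow>
        (\<alpha>s ! j) z \<in> K_reg x \<and> value_at u ((\<alpha>s ! j) z) x = R (u x) (u z) / denom (u x) (u z))"
    if "j < length \<alpha>s" for j
    using monomial(1)[OF nth_mem[OF that]] unfolding form_family_def .
  then obtain R where R: "\<And>j. j < length \<alpha>s \<Longrightarrow> bipolynomial (R j)"
    "\<And>j z x. j < length \<alpha>s \<Longrightarrow> good z \<Longrightarrow> \<not> pole_at u x \<Longrightarrow> denom (u x) (u z) \<noteq> 0 \<Longrightarrow>
        (\<alpha>s ! j) z \<in> K_reg x \<and> value_at u ((\<alpha>s ! j) z) x = R j (u x) (u z) / denom (u x) (u z)"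
    by metis
  define P where "P l = (if length \<alpha>s = m then
      poly p (l ! m) * (\<Sum>\<sigma> | \<sigma> permutes {..<m}. \<Prod>i<m. R (\<sigma> i) (l ! i) (l ! m)) else 0)" for l
  have "polynomial_fun (Suc m) P"
  proof (cases "length \<alpha>s = m")
    case True
    have "polynomial_fun (Suc m) (\<lambda>l. R (\<sigma> i) (l ! i) (l ! m))" if "\<sigma> permutes {..<m}" "i < m" for \<sigma> i
      using R(1)[of "\<sigma> i"] permutes_in_image[OF that(1), of i] that True
      by (simp add: bipolynomial_def)
    then have "polynomial_fun (Suc m) (\<lambda>l. poly p (l ! m) *
        (\<Sum>\<sigma> | \<sigma> permutes {..<m}. \<Prod>i<m. R (\<sigma> i) (l ! i) (l ! m)))"
      by (intro polynomial_fun.mult polynomial_fun_sum polynomial_fun_prod polynomial_fun_poly) auto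
    then show ?thesis using True unfolding P_def by simp
  next
    case False
    then show ?thesis unfolding P_def by (simp add: polynomial_fun.const)
  qed
  moreover have "polydiff_regular xs (F z) \<and>
       polydiff u xs (F z) = P (map u xs @ [u z]) / (poly r (u z) * (\<Prod>i<m. denom (u (xs ! i)) (u z)))"
    if z: "good z" and xs: "length xs = m" "\<forall>x\<in>set xs. \<not> pole_at u x \<and> denom (u x) (u z) \<noteq> 0" for z xs
  proof -
    let ?as = "map (\<lambda>\<alpha>. \<alpha> z) \<alpha>s"
    have Fz: "F z = (poly p (u z) / poly r (u z)) *\<^sub>C prod_list (map sym_gen ?as)"
      using monomial(3)[OF z] by (simp add: o_def)
    have reg: "a \<in> K_reg x" if "a \<in> set ?as" "x \<in> set xs" for a x
      using that R(2) z xs by (force simp: in_set_conv_nth)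
    have val: "value_at u (?as ! \<sigma> i) (xs ! i) = R (\<sigma> i) (u (xs ! i)) (u z) / denom (u (xs ! i)) (u z)"
      if "\<sigma> permutes {..<m}" "i < m" "length \<alpha>s = m" for \<sigma> i
    proof -
      have "\<sigma> i < m" using permutes_in_image[OF that(1), of i] that(2) by simp
      then show ?thesis using R(2)[of "\<sigma> i" z "xs ! i"] that z xs by simp
    qed
    have "polydiff u xs (F z) = (if length \<alpha>s = m then poly p (u z) / poly r (u z) *
        (\<Sum>\<sigma> | \<sigma> permutes {..<m}. \<Prod>i<m. R (\<sigma> i) (u (xs ! i)) (u z) / denom (u (xs ! i)) (u z)) else 0)"
    proof -
      have "polydiff u xs (F z) = (if length ?as = length xs then poly p (u z) / poly r (u z) *
          (\<Sum>\<sigma> | \<sigma> permutes {..<length xs}. \<Prod>i<length xs. value_at u (?as ! \<sigma> i) (xs ! i)) else 0)"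
        unfolding Fz by (intro polydiff_monomial reg)
      then show ?thesis using xs(1) val by (simp del: nth_map)
    qed
    also have "\<dots> = P (map u xs @ [u z]) / (poly r (u z) * (\<Prod>i<m. denom (u (xs ! i)) (u z)))"
      unfolding P_def using xs(1)
      by (simp add: nth_append prod_dividef flip: sum_divide_distrib)
    finally have "polydiff u xs (F z) = P (map u xs @ [u z]) / (poly r (u z) * (\<Prod>i<m. denom (u (xs ! i)) (u z)))" .
    moreover have "polydiff_regular xs (F z)"
      unfolding Fz by (intro polydiff_monomial reg)
    ultimately show ?thesis by simp
  qed
  ultimately show ?case using monomial(2) by blast
next
  case (add F G H)
  obtain P r where P: "polynomial_fun (Suc m) P" "\<forall>z. good z \<longrightarrow> poly r (u z) \<noteq> 0"
    "\<forall>z xs. good z \<and> length xs = m \<and> (\<forall>x\<in>set xs. \<not> pole_at u x \<and> denom (u x) (u z) \<noteq> 0) \<longrightarrow>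
       polydiff_regular xs (F z) \<and>
       polydiff u xs (F z) = P (map u xs @ [u z]) / (poly r (u z) * (\<Prod>i<m. denom (u (xs ! i)) (u z)))"
    using add.IH(1) by blast
  obtain P' r' where P': "polynomial_fun (Suc m) P'" "\<forall>z. good z \<longrightarrow> poly r' (u z) \<noteq> 0"
    "\<forall>z xs. good z \<and> length xs = m \<and> (\<forall>x\<in>set xs. \<not> pole_at u x \<and> denom (u x) (u z) \<noteq> 0) \<longrightarrow>
       polydiff_regular xs (G z) \<and>
       polydiff u xs (G z) = P' (map u xs @ [u z]) / (poly r' (u z) * (\<Prod>i<m. denom (u (xs ! i)) (u z)))"
    using add.IH(2) by blast
  let ?S = "\<lambda>l. P l * poly r' (l ! m) + P' l * poly r (l ! m)"
  have "polynomial_fun (Suc m) ?S"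
    by (intro polynomial_fun.add polynomial_fun.mult P P' polynomial_fun_poly) auto
  moreover have "\<forall>z. good z \<longrightarrow> poly (r * r') (u z) \<noteq> 0" using P(2) P'(2) by simp
  moreover have "polydiff_regular xs (H z) \<and>
       polydiff u xs (H z) = ?S (map u xs @ [u z]) / (poly (r * r') (u z) * (\<Prod>i<m. denom (u (xs ! i)) (u z)))"
    if zx: "good z \<and> length xs = m \<and> (\<forall>x\<in>set xs. \<not> pole_at u x \<and> denom (u x) (u z) \<noteq> 0)" for z xs
  proof -
    have nz: "poly r (u z) \<noteq> 0" "poly r' (u z) \<noteq> 0" using zx P(2) P'(2) by auto
    have FG: "polydiff_regular xs (F z)" "polydiff_regular xs (G z)" using zx P(3) P'(3) by auto
    have *: "A / (s * D) + A' / (s' * D) = (A * s' + A' * s) / (s * s' * D)"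
      if "s \<noteq> 0" "s' \<noteq> 0" for A A' s s' D :: complex
      using that by (cases "D = 0") (simp_all add: field_simps)
    have "polydiff u xs (H z) = polydiff u xs (F z) + polydiff u xs (G z)"
      using zx add.hyps polydiff_add(2)[OF FG] by simp
    also have "\<dots> = ?S (map u xs @ [u z]) / (poly (r * r') (u z) * (\<Prod>i<m. denom (u (xs ! i)) (u z)))"
      using zx P(3) P'(3) *[OF nz] by (auto simp: nth_append)
    finally show ?thesis using zx add.hyps polydiff_add(1)[OF FG] by simp
  qed
  ultimately show ?case by blast
qed

text \<open>A good parameter admits auxiliary points because all of them may be taken equal.\<close>

lemma rational_family_tends_to:
  assumes "rational_family G" "finite B" "z1 \<notin> B" "\<And>z. good z \<longleftrightarrow> z \<notin> B \<and> \<not> pole_at u z"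
    "\<And>z. good z \<Longrightarrow> (if z = z1 then w else F z) = G z"
  shows "tends_to u z1 F w"
  unfolding tends_to_def
proof (intro exI[of _ B] conjI allI)
  fix m
  obtain P r where P: "polynomial_fun (Suc m) P" "\<forall>z. good z \<longrightarrow> poly r (u z) \<noteq> 0"
    "\<forall>z xs. good z \<and> length xs = m \<and> (\<forall>x\<in>set xs. \<not> pole_at u x \<and> denom (u x) (u z) \<noteq> 0) \<longrightarrow>
       polydiff_regular xs (G z) \<and>
       polydiff u xs (G z) = P (map u xs @ [u z]) / (poly r (u z) * (\<Prod>i<m. denom (u (xs ! i)) (u z)))"
    using rational_family_component[OF assms(1)] by blast
  define Q where "Q l = poly r (l ! m) * (\<Prod>i<m. denom (l ! i) (l ! m))" for l
  have Q: "polynomial_fun (Suc m) Q"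
    unfolding Q_def using denom_bipolynomial
    by (intro polynomial_fun.mult polynomial_fun_prod polynomial_fun_poly) (auto simp: bipolynomial_def)
  have Q_eq: "Q (map u xs @ [u z]) = poly r (u z) * (\<Prod>i<m. denom (u (xs ! i)) (u z))" if "length xs = m" for xs z
    using that by (simp add: Q_def nth_append)
  have ex: "\<exists>xs. length xs = m \<and> (\<forall>x\<in>set xs. \<not> pole_at u x) \<and> Q (map u xs @ [u z]) \<noteq> 0" if "good z" for z
  proof -
    obtain x where "\<not> pole_at u x" "denom (u x) (u z) \<noteq> 0" using denom_generic[OF \<open>good z\<close>] by blast
    then show ?thesis using P(2) that by (intro exI[of _ "replicate m x"]) (simp add: Q_def nth_append)
  qed
  have val: "let v = (if z = z1 then w else F z) in
              polydiff_regular xs v \<and> polydiff u xs v = P (map u xs @ [u z]) / Q (map u xs @ [u z])"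
    if "good z" "length xs = m" "\<forall>x\<in>set xs. \<not> pole_at u x" "Q (map u xs @ [u z]) \<noteq> 0" for z xs
  proof -
    have "\<forall>x\<in>set xs. denom (u x) (u z) \<noteq> 0"
      using that(2,4) by (auto simp: Q_eq in_set_conv_nth)
    then show ?thesis
      using P(3) that(1-3) unfolding Let_def assms(5)[OF that(1)] by (simp add: Q_eq)
  qed
  show "\<exists>P Q. polynomial_fun (Suc m) P \<and> polynomial_fun (Suc m) Q \<and>
        (\<forall>z. z \<notin> B \<and> \<not> pole_at u z \<longrightarrow>
          (\<exists>xs. length xs = m \<and> (\<forall>x\<in>set xs. \<not> pole_at u x) \<and> Q (map u xs @ [u z]) \<noteq> 0) \<and>
          (\<forall>xs. length xs = m \<and> (\<forall>x\<in>set xs. \<not> pole_at u x) \<and> Q (map u xs @ [u z]) \<noteq> 0 \<longrightarrow>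
            (let v = (if z = z1 then w else F z) in
              polydiff_regular xs v \<and>
              polydiff u xs v = P (map u xs @ [u z]) / Q (map u xs @ [u z]))))"
    using P(1) Q ex val unfolding assms(4) by blast
qed (use assms in auto)

end

section \<open>Normal ordering\<close>

lemma minus_value_at_linear: "complex_linear_on (K_reg z) (\<lambda>\<alpha>. - value_at u \<alpha> z)"
  using value_at_linear[of z u] by (simp add: complex_linear_on_def)

lemmas i_field_one = sym_derivation_one[OF minus_value_at_linear, folded i_field_def]
  and i_field_gen = sym_derivation_gen[OF minus_value_at_linear, folded i_field_def]
  and i_field_add = sym_derivation_add[OF minus_value_at_linear, folded i_field_def]
  and i_field_scaleC = sym_derivation_scaleC[OF minus_value_at_linear, folded i_field_def]
  and i_field_mult = sym_derivation_mult[OF minus_value_at_linear, folded i_field_def]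
  and i_field_Sym = sym_derivation_Sym[OF minus_value_at_linear, folded i_field_def]

lemma scaleC_two: "2 *\<^sub>C (x :: 'a::complex_vector_space) = x + x"
  using scaleC_add_left[of 1 1 x] by (simp add: scaleC_one)

lemma scaleC_three: "3 *\<^sub>C (x :: 'a::complex_vector_space) = x + x + x"
  using scaleC_add_left[of 2 1 x] by (simp add: scaleC_one scaleC_two)

lemma finite_irregular_points:
  assumes "moebius u a b c d" "finite A" "v \<in> Sym A"
  shows "finite {z. v \<notin> W_reg z}"
proof (rule finite_subset)
  show "{z. v \<notin> W_reg z} \<subseteq> (\<Union>\<alpha>\<in>A. {z. \<alpha> \<notin> K_reg z})"
    using Sym_mono[OF assms(3)] by blast
  show "finite (\<Union>\<alpha>\<in>A. {z. \<alpha> \<notin> K_reg z})"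
    using assms(2) moebius.finite_singular_points[OF assms(1)] by blast
qed

text \<open>
  The product of \<open>b(z)\<close> and \<open>2 T(z\<^sub>1)\<close> with powers of \<open>e\<close> to the left of powers of \<open>i\<close>, as if \<open>i(z)\<close>
  and \<open>e(z\<^sub>1)\<close> commuted.
\<close>

definition normal_ordered where
  "normal_ordered u z1 v z =
     i_field u z (i_field u z1 (i_field u z1 v))
     + sym_gen (e_form u z1) * (sym_gen (e_form u z1) * i_field u z v)
     + 2 *\<^sub>C (sym_gen (e_form u z1) * i_field u z (i_field u z1 v))
     + sym_gen (e_form u z) * (i_field u z1 (i_field u z1 v)
        + sym_gen (e_form u z1) * (sym_gen (e_form u z1) * v)
        + 2 *\<^sub>C (sym_gen (e_form u z1) * i_field u z1 v))"

lemma normal_ordered_diagonal: "normal_ordered u z1 v z1 = S_field u z1 v"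
  by (simp add: normal_ordered_def S_field_def e_field_def scaleC_two scaleC_three algebra_simps)

text \<open>
  Each of the two factors in \<open>e(z\<^sub>1) e(z\<^sub>1)\<close> and the one factor in \<open>2 e(z\<^sub>1) i(z\<^sub>1)\<close> contributes one contraction
  \<open>\<omega>\<close> when \<open>i(z)\<close> passes it, and the total is \<open>2 \<omega> (e(z\<^sub>1) + i(z\<^sub>1)) v\<close>.
\<close>

lemma (in moebius) b_T_minus_contraction:
  assumes z: "\<not> pole_at u z" "\<not> pole_at u z1" "z \<noteq> z1"
    and A: "v \<in> Sym A" "A \<subseteq> K_reg z" "A \<subseteq> K_reg z1"
  shows "2 *\<^sub>C b_field u z (T_field u z1 v) - (2 * omega u z z1) *\<^sub>C b_field u z1 v = normal_ordered u z1 v z"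
proof -
  define e where "e = sym_gen (e_form u z1)"
  define E where "E = sym_gen (e_form u z)"
  define v1 where "v1 = i_field u z1 v"
  define v2 where "v2 = i_field u z1 v1"
  define w where "w = omega u z z1"
  have "v1 \<in> Sym A" unfolding v1_def by (rule i_field_Sym[OF A(3,1)])
  then have "v2 \<in> Sym A" unfolding v2_def by (rule i_field_Sym[OF A(3)])
  have e_reg: "e_form u z1 \<in> K_reg z" using e_form_regular z by simp
  have Wz: "v \<in> W_reg z" "v1 \<in> W_reg z" "v2 \<in> W_reg z" "e \<in> W_reg z"
    using A(1) \<open>v1 \<in> Sym A\<close> \<open>v2 \<in> Sym A\<close> Sym_mono[OF _ A(2)] e_reg by (auto simp: e_def intro: Sym.gen)
  have comm: "i_field u z e = w *\<^sub>C 1"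
    unfolding e_def i_field_gen[OF e_reg] using z by (simp add: value_at_e_form w_def omega_def)
  have T: "2 *\<^sub>C T_field u z1 v = v2 + e * (e * v) + 2 *\<^sub>C (e * v1)"
    by (simp add: T_field_def e_field_def v1_def v2_def e_def scaleC_scaleC scaleC_one)
  have T_reg: "T_field u z1 v \<in> W_reg z"
    using Wz by (simp add: T_field_def e_field_def v1_def v2_def e_def Sym.intros)
  have "2 *\<^sub>C i_field u z (T_field u z1 v) = i_field u z (v2 + e * (e * v) + 2 *\<^sub>C (e * v1))"
    using i_field_scaleC[OF T_reg, of u 2] by (simp add: T)
  also have "\<dots> = i_field u z v2 + i_field u z (e * (e * v)) + 2 *\<^sub>C i_field u z (e * v1)"
    using Wz by (simp add: i_field_add i_field_scaleC Sym.intros)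
  also have "i_field u z (e * (e * v)) = e * (e * i_field u z v) + 2 *\<^sub>C (w *\<^sub>C (e * v))"
    using Wz by (simp add: i_field_mult Sym.intros comm scaleC_mult_left scaleC_mult_right
        scaleC_two distrib_left add_ac)
  also have "i_field u z (e * v1) = w *\<^sub>C v1 + e * i_field u z v1"
    using Wz by (simp add: i_field_mult comm scaleC_mult_left)
  also have "i_field u z v2 + (e * (e * i_field u z v) + 2 *\<^sub>C (w *\<^sub>C (e * v)))
        + 2 *\<^sub>C (w *\<^sub>C v1 + e * i_field u z v1)
      = i_field u z v2 + e * (e * i_field u z v) + 2 *\<^sub>C (e * i_field u z v1)
        + 2 *\<^sub>C (w *\<^sub>C (v1 + e * v))"
    by (simp add: scaleC_add_right add_ac)
  finally have iT: "2 *\<^sub>C i_field u z (T_field u z1 v) = i_field u z v2 + e * (e * i_field u z v)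
      + 2 *\<^sub>C (e * i_field u z v1) + 2 *\<^sub>C (w *\<^sub>C (v1 + e * v))" .
  have "2 *\<^sub>C (E * T_field u z1 v) = E * (v2 + e * (e * v) + 2 *\<^sub>C (e * v1))"
    by (simp add: scaleC_mult_right flip: T)
  then show ?thesis
    using iT unfolding b_field_def e_field_def normal_ordered_def
    by (simp add: scaleC_add_right scaleC_scaleC e_def E_def v1_def v2_def w_def)
qed

theorem proposition4p2:
  fixes u :: "pline \<Rightarrow> complex" and z1 :: pline and v :: "form sym_alg"
  assumes "coordinate u" and "\<not> pole_at u z1" and "v \<in> W_reg z1"
  shows "finite {z2. z2 \<noteq> z1 \<and> T_field u z1 v \<notin> W_reg z2} \<and>
    tends_to u z1
      (\<lambda>z2. 2 *\<^sub>C b_field u z2 (T_field u z1 v) - (2 * omega u z2 z1) *\<^sub>C b_field u z1 v)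
      (S_field u z1 v)"
proof -
  obtain a b c d where "moebius u a b c d" using coordinate_imp_moebius[OF assms(1)] .
  then interpret moebius u a b c d .
  obtain A where A: "finite A" "A \<subseteq> K_reg z1" "v \<in> Sym A"
    using Sym_finite_support[OF assms(3)] .
  note i_A = i_field_Sym[OF A(2)]
  obtain q where q: "poly q (u z1) \<noteq> 0"
    "\<forall>\<alpha>\<in>A. \<exists>p. \<forall>x. \<not> pole_at u x \<and> poly q (u x) \<noteq> 0 \<longrightarrow>
       \<alpha> \<in> K_reg x \<and> value_at u \<alpha> x = poly p (u x) / poly q (u x)"
    using forms_common_denominator[OF assms(2) A(1,2)] by blast
  \<comment> \<open>Away from \<open>B\<close> all forms of \<open>A\<close> are regular, and \<open>z1\<close> is not in \<open>B\<close> because the common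
    denominator does not vanish there.\<close>
  define B where "B = {x. \<not> pole_at u x \<and> u x \<in> {y. poly q y = 0}}"
  define good where "good z \<longleftrightarrow> z \<notin> B \<and> \<not> pole_at u z" for z
  \<comment> \<open>The last two factors are the denominators of the values of \<open>e(z)\<close> and of \<open>e(z\<^sub>1)\<close>.\<close>
  define denom where "denom x z = poly q x * (x - z)\<^sup>2 * (x - u z1)\<^sup>2" for x z
  have "q \<noteq> 0" using q(1) by auto
  then have B: "finite B" unfolding B_def by (intro finite_u_vimage poly_roots_finite)
  have qz: "poly q (u z) \<noteq> 0" if "good z" for z using that by (auto simp: good_def B_def)
  interpret rational_families u a b c d good denom
  proof
    show "\<not> pole_at u z" if "good z" for z using that by (simp add: good_def)
    show "bipolynomial denom"
      unfolding denom_def[abs_def]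
      by (intro bipolynomial_mult bipolynomial_first bipolynomial_diff_squared bipolynomial_diff_const_squared)
    show "\<exists>x. \<not> pole_at u x \<and> denom (u x) (u z) \<noteq> 0" if "good z" for z
    proof -
      have "finite ({x. pole_at u x} \<union> {x. \<not> pole_at u x \<and> u x \<in> {y. poly q y = 0} \<union> {u z, u z1}})"
        using \<open>q \<noteq> 0\<close> by (intro finite_UnI finite_poles finite_u_vimage) (auto simp: poly_roots_finite)
      then obtain x where "x \<notin> {x. pole_at u x} \<union> {x. \<not> pole_at u x \<and> u x \<in> {y. poly q y = 0} \<union> {u z, u z1}}"
        using infinite_affine_points by (metis UNIV_I finite_subset subsetI)
      then show ?thesis by (intro exI[of _ x]) (auto simp: denom_def)
    qed
  qed
  have A_reg: "A \<subseteq> K_reg z" if "good z" for z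
    using q(2) qz[OF that] good_nonpole[OF that] by blast
  have form_A: "form_family (\<lambda>z. \<alpha>)" if "\<alpha> \<in> A" for \<alpha>
  proof -
    obtain p where p: "\<forall>x. \<not> pole_at u x \<and> poly q (u x) \<noteq> 0 \<longrightarrow>
       \<alpha> \<in> K_reg x \<and> value_at u \<alpha> x = poly p (u x) / poly q (u x)" using q(2) \<open>\<alpha> \<in> A\<close> by blast
    have "bipolynomial (\<lambda>x z. poly p x * (x - z)\<^sup>2 * (x - u z1)\<^sup>2)"
      by (intro bipolynomial_mult bipolynomial_first bipolynomial_diff_squared bipolynomial_diff_const_squared)
    then show ?thesis
      unfolding form_family_def
      by (rule exI[of _ "\<lambda>x z. poly p x * (x - z)\<^sup>2 * (x - u z1)\<^sup>2", OF conjI]) (use p in \<open>auto simp: denom_def\<close>)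
  qed
  have form_e: "form_family (e_form u)"
  proof -
    have "e_form u z \<in> K_reg x \<and> value_at u (e_form u z) x = - 1 / (u x - u z)\<^sup>2"
      if "good z" "\<not> pole_at u x" "u x \<noteq> u z" for x z
      using that e_form_regular[of z x] value_at_e_form[of z x] good_nonpole[of z] by auto
    moreover have "bipolynomial (\<lambda>x z. (- 1) * poly q x * (x - u z1)\<^sup>2)"
      by (intro bipolynomial_mult bipolynomial_const bipolynomial_first bipolynomial_diff_const_squared)
    ultimately show ?thesis
      unfolding form_family_def
      by (intro exI[of _ "\<lambda>x z. (- 1) * poly q x * (x - u z1)\<^sup>2"]) (auto simp: denom_def)
  qed
  have form_e1: "form_family (\<lambda>z. e_form u z1)"
  proof -
    have "bipolynomial (\<lambda>x z. (- 1) * poly q x * (x - z)\<^sup>2)"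
      by (intro bipolynomial_mult bipolynomial_const bipolynomial_first bipolynomial_diff_squared)
    then show ?thesis
      unfolding form_family_def
      by (rule exI[of _ "\<lambda>x z. (- 1) * poly q x * (x - z)\<^sup>2", OF conjI])
        (use e_form_regular[OF assms(2)] value_at_e_form[OF assms(2)] in \<open>auto simp: denom_def\<close>)
  qed
  \<comment> \<open>Only vectors over the fixed finite set \<open>A\<close> occur, so one neighbourhood serves for all of
    \<open>v\<close>, \<open>i(z\<^sub>1) v\<close> and \<open>i(z\<^sub>1) i(z\<^sub>1) v\<close>.\<close>
  have const_family: "rational_family (\<lambda>z. w)" if "w \<in> Sym A" for w
    using that
  proof induction
    case one
    show ?case by (rule rational_family_scalar[of 1 _ 1]) (simp_all add: scaleC_one)
  qed (simp_all add: rational_family_gen form_A rational_family_plus rational_family_mult rational_family_scaleC)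
  have i_family: "rational_family (\<lambda>z. i_field u z w)" if "w \<in> Sym A" for w
    using that
  proof induction
    case one
    show ?case by (rule rational_family_scalar[of 1 _ 0]) (simp_all add: i_field_one)
  next
    case (gen \<alpha>)
    then obtain p where p: "\<forall>x. \<not> pole_at u x \<and> poly q (u x) \<noteq> 0 \<longrightarrow>
       \<alpha> \<in> K_reg x \<and> value_at u \<alpha> x = poly p (u x) / poly q (u x)" using q(2) by blast
    show ?case
      by (rule rational_family_scalar[of q _ "- p"]) (use p qz good_nonpole in \<open>auto simp: i_field_gen\<close>)
  next
    case (add v w)
    show ?case
      by (rule rational_family.add[OF add.IH])
        (use add.hyps Sym_mono[OF _ A_reg] in \<open>simp add: i_field_add\<close>)
  next
    case (mult v w)
    have *: "rational_family (\<lambda>z. i_field u z v * w)" "rational_family (\<lambda>z. v * i_field u z w)"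
      by (intro rational_family_mult mult.IH const_family mult.hyps)+
    show ?case
      by (rule rational_family.add[OF *])
        (use mult.hyps Sym_mono[OF _ A_reg] in \<open>simp add: i_field_mult\<close>)
  next
    case (scale v k)
    have "rational_family (\<lambda>z. 0)"
      by (rule rational_family_scalar[of 1 _ 0]) simp_all
    then show ?case
      by (rule rational_family.add[OF rational_family_scaleC[OF scale.IH, of k]])
        (use scale.hyps Sym_mono[OF _ A_reg] in \<open>simp add: i_field_scaleC\<close>)
  qed
  have fam: "rational_family (normal_ordered u z1 v)"
    unfolding normal_ordered_def[abs_def]
    by (intro rational_family_plus rational_family_mult rational_family_scaleC rational_family_gen
        i_family const_family form_e form_e1 i_A A(3))
  have "tends_to u z1
      (\<lambda>z2. 2 *\<^sub>C b_field u z2 (T_field u z1 v) - (2 * omega u z2 z1) *\<^sub>C b_field u z1 v)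
      (S_field u z1 v)"
  proof (rule rational_family_tends_to[OF fam B])
    show "z1 \<notin> B" using q(1) by (simp add: B_def)
    fix z
    show "good z \<longleftrightarrow> z \<notin> B \<and> \<not> pole_at u z" by (rule good_def)
    assume "good z"
    then show "(if z = z1 then S_field u z1 v
       else 2 *\<^sub>C b_field u z (T_field u z1 v) - (2 * omega u z z1) *\<^sub>C b_field u z1 v) = normal_ordered u z1 v z"
      using b_T_minus_contraction[OF good_nonpole assms(2) _ A(3) A_reg A(2)] by (simp add: normal_ordered_diagonal)
  qed
  moreover have "finite {z. T_field u z1 v \<notin> W_reg z}"
  proof (rule finite_irregular_points)
    show "moebius u a b c d" by (rule moebius_axioms)
    have sub: "w \<in> Sym (insert (e_form u z1) A)" if "w \<in> Sym A" for w
      using Sym_mono[OF that] by blast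
    show "T_field u z1 v \<in> Sym (insert (e_form u z1) A)"
      unfolding T_field_def e_field_def
      by (intro Sym.scale Sym.add Sym.mult Sym.gen sub i_A A(3)) auto
  qed (simp add: A(1))
  then have "finite {z2. z2 \<noteq> z1 \<and> T_field u z1 v \<notin> W_reg z2}"
    by (rule rev_finite_subset) auto
  ultimately show ?thesis by blast
qed

end
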